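(* Let $E$ and $F$ be two Banach lattices such that $F$ has property (d). Let $S,T:E\to F$ be two positive operators such that $0\le S\le T$. Then $S$ is weak almost limited whenever $T$ is weak almost limited.
   Context: All Banach lattices are real; "operator" means bounded linear mapping. A sequence $(f_n)$ in a Banach lattice is disjoint if $|f_n|\wedge|f_m|=0$ for $n\neq m$. A Banach lattice $F$ has property (d) if $|f_n|\xrightarrow{w^*}0$ in $F^*$ for every disjoint sequence $(f_n)$ in $F^*$ with $f_n\xrightarrow{w^*}0$. A norm bounded subset $A$ of a Banach lattice $F$ is an almost limited set if every disjoint weak* null sequence $(f_n)$ in $F^*$ satisfies $\sup_{y\in A}|f_n(y)|\to 0$. An operator $T:X\to F$ from a Banach space into a Banach lattice is weak almost limited if $T$ carries each relatively weakly compact set in $X$ to an almost limited set in $F$. *)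

theory Defs
  imports "HOL-Analysis.Analysis" "HOL-Library.Lattice_Algebras"
begin

section \<open>Banach lattices and positive operators\<close>

class banach_lattice = banach + ordered_real_vector + lattice_ab_group_add_abs +
  assumes norm_abs_mono: "\<bar>x\<bar> \<le> \<bar>y\<bar> \<Longrightarrow> norm x \<le> norm y"

instance real :: banach_lattice
  by standard auto

definition op_le :: "('a::banach_lattice \<Rightarrow>\<^sub>L 'b::banach_lattice) \<Rightarrow> ('a \<Rightarrow>\<^sub>L 'b) \<Rightarrow> bool"
  where "op_le S T \<longleftrightarrow> (\<forall>x. 0 \<le> x \<longrightarrow> blinfun_apply S x \<le> blinfun_apply T x)"

definition positive_op :: "('a::banach_lattice \<Rightarrow>\<^sub>L 'b::banach_lattice) \<Rightarrow> bool"
  where "positive_op T \<longleftrightarrow> (\<forall>x. 0 \<le> x \<longrightarrow> 0 \<le> blinfun_apply T x)"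

section \<open>The lattice structure of the dual\<close>

text \<open>
  The norm dual of \<open>'a\<close> is the type \<open>'a \<Rightarrow>\<^sub>L real\<close>, ordered by \<open>op_le\<close>. Its lattice operations
  are the least upper bound and the greatest lower bound with respect to this order. They exist
  by the Riesz--Kantorovich theorem, proved below as \<open>dual_sup\<close> and \<open>dual_inf\<close>, so that
  the descriptions are proper.
\<close>

definition dual_sup :: "('a::banach_lattice \<Rightarrow>\<^sub>L real) \<Rightarrow> ('a \<Rightarrow>\<^sub>L real) \<Rightarrow> ('a \<Rightarrow>\<^sub>L real)"
  where "dual_sup f g =
    (THE h. op_le f h \<and> op_le g h \<and> (\<forall>k. op_le f k \<and> op_le g k \<longrightarrow> op_le h k))"

definition dual_inf :: "('a::banach_lattice \<Rightarrow>\<^sub>L real) \<Rightarrow> ('a \<Rightarrow>\<^sub>L real) \<Rightarrow> ('a \<Rightarrow>\<^sub>L real)"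
  where "dual_inf f g =
    (THE h. op_le h f \<and> op_le h g \<and> (\<forall>k. op_le k f \<and> op_le k g \<longrightarrow> op_le k h))"

definition dual_abs :: "('a::banach_lattice \<Rightarrow>\<^sub>L real) \<Rightarrow> ('a \<Rightarrow>\<^sub>L real)"
  where "dual_abs f = dual_sup f (- f)"

lemma norm_pprt_le: "norm (pprt x) \<le> norm (x::'a::banach_lattice)"
proof (rule norm_abs_mono)
  have "pprt x \<le> \<bar>x\<bar>" unfolding pprt_def by (simp add: abs_ge_self)
  then show "\<bar>pprt x\<bar> \<le> \<bar>x\<bar>" by (simp add: abs_of_nonneg)
qed

lemma pos_decomp: obtains a b where "(x::'a::banach_lattice) = a - b" "0 \<le> a" "0 \<le> b"
proof (rule that)
  show "x = pprt x - (- nprt x)" using prts[of x] by simp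
qed simp_all

lemma op_le_antisym:
  fixes S T :: "'a::banach_lattice \<Rightarrow>\<^sub>L 'b::banach_lattice"
  assumes "op_le S T" "op_le T S" shows "S = T"
proof (rule blinfun_eqI)
  fix x :: 'a
  obtain a b where x: "x = a - b" "0 \<le> a" "0 \<le> b" by (rule pos_decomp)
  then have "blinfun_apply S a = blinfun_apply T a" "blinfun_apply S b = blinfun_apply T b"
    using assms unfolding op_le_def by (auto intro: order.antisym)
  then show "blinfun_apply S x = blinfun_apply T x" by (simp add: x blinfun.diff_right)
qed

lemma op_le_uminus: "op_le (- f) (- g) \<longleftrightarrow> op_le g f"
  by (simp add: op_le_def blinfun.minus_left)

lemma functional_extension:
  fixes p :: "'a::banach_lattice \<Rightarrow> real"
  assumes add: "\<And>x y. 0 \<le> x \<Longrightarrow> 0 \<le> y \<Longrightarrow> p (x + y) = p x + p y"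
    and hom: "\<And>c x. 0 < c \<Longrightarrow> 0 \<le> x \<Longrightarrow> p (c *\<^sub>R x) = c * p x"
    and bdd: "\<And>x. 0 \<le> x \<Longrightarrow> \<bar>p x\<bar> \<le> C * norm x" and C: "0 \<le> C"
  shows "\<exists>h. \<forall>x\<ge>0. blinfun_apply h x = p x"
proof -
  define q where "q x = p (pprt x) - p (- nprt x)" for x
  have q: "q (a - b) = p a - p b" if "0 \<le> a" "0 \<le> b" for a b
  proof -
    have "pprt (a - b) + b = a + - nprt (a - b)"
      using prts[of "a - b"] by (metis add.commute add_diff_cancel_left' diff_add_cancel diff_conv_add_uminus add.assoc)
    then have "p (pprt (a - b)) + p b = p a + p (- nprt (a - b))"
      using that by (metis add zero_le_pprt nprt_le_zero neg_0_le_iff_le)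
    then show ?thesis by (simp add: q_def)
  qed
  have p0: "p 0 = 0" using add[of 0 0] by simp
  have qa: "q (x + y) = q x + q y" for x y
  proof -
    obtain a b where x: "x = a - b" "0 \<le> a" "0 \<le> b" by (rule pos_decomp)
    obtain c d where y: "y = c - d" "0 \<le> c" "0 \<le> d" by (rule pos_decomp)
    have "x + y = (a + c) - (b + d)" by (simp add: x y)
    then have "q (x + y) = p (a + c) - p (b + d)" using x(2,3) y(2,3) q[of "a + c" "b + d"] by simp
    moreover have "q x = p a - p b" "q y = p c - p d" using x y q by auto
    ultimately show ?thesis using x y by (simp add: add)
  qed
  have qs0: "q (c *\<^sub>R x) = c * q x" if "0 < c" for c x
  proof -
    obtain a b where x: "x = a - b" "0 \<le> a" "0 \<le> b" by (rule pos_decomp)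
    have "c *\<^sub>R x = c *\<^sub>R a - c *\<^sub>R b" by (simp add: x scaleR_diff_right)
    moreover have "0 \<le> c *\<^sub>R a" "0 \<le> c *\<^sub>R b"
      using x that by (auto intro: scaleR_nonneg_nonneg)
    ultimately have "q (c *\<^sub>R x) = p (c *\<^sub>R a) - p (c *\<^sub>R b)" by (simp add: q)
    moreover have "q x = p a - p b" using x q by simp
    ultimately show ?thesis using x(2,3) that by (simp add: hom right_diff_distrib)
  qed
  have q0: "q 0 = 0" using q[of 0 0] by simp
  have qm: "q (- x) = - q x" for x using qa[of x "-x"] q0 by simp
  have qs: "q (c *\<^sub>R x) = c * q x" for c x
  proof (cases c "0::real" rule: linorder_cases)
    case less
    then show ?thesis using qs0[of "-c" x] qm[of "c *\<^sub>R x"] by simp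
  qed (auto simp: q0 qs0)
  have qb: "\<bar>q x\<bar> \<le> norm x * (2 * C)" for x
  proof -
    have "- nprt x = pprt (- x)" by (simp add: pprt_neg)
    then have "norm (- nprt x) \<le> norm x" using norm_pprt_le[of "-x"] by simp
    then have "\<bar>p (- nprt x)\<bar> \<le> C * norm x"
      using bdd[of "- nprt x"] C mult_left_mono by fastforce
    moreover have "\<bar>p (pprt x)\<bar> \<le> C * norm x"
      using bdd[of "pprt x"] mult_left_mono[OF norm_pprt_le C, of x] by simp
    ultimately show ?thesis unfolding q_def by (simp add: algebra_simps)
  qed
  have "bounded_linear q"
    by (rule bounded_linear_intro[where K = "2 * C"]) (auto simp: qa qs qb)
  then have "\<forall>x\<ge>0. blinfun_apply (Blinfun q) x = p x"
    using q[of _ 0] p0 by (simp add: bounded_linear_Blinfun_apply)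
  then show ?thesis by blast
qed

lemma riesz_kantorovich:
  fixes f g :: "'a::banach_lattice \<Rightarrow>\<^sub>L real"
  shows "\<exists>h. op_le f h \<and> op_le g h \<and> (\<forall>k. op_le f k \<and> op_le g k \<longrightarrow> op_le h k) \<and>
    (\<forall>x\<ge>0. blinfun_apply h x =
      (SUP y\<in>{0..x}. blinfun_apply f y + blinfun_apply g (x - y)))"
proof -
  define t where "t x y = blinfun_apply f y + blinfun_apply g (x - y)" for x y
  define C where "C = norm f + norm g"
  have C: "0 \<le> C" by (simp add: C_def)
  have tb: "\<bar>t x y\<bar> \<le> C * norm x" if "y \<in> {0..x}" for x y
  proof -
    have x: "0 \<le> x" using that by (auto intro: order_trans)
    have "norm y \<le> norm x" "norm (x - y) \<le> norm x"
      using that x by (auto intro!: norm_abs_mono simp: abs_of_nonneg)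
    moreover have "\<bar>blinfun_apply f y\<bar> \<le> norm f * norm y"
      "\<bar>blinfun_apply g (x - y)\<bar> \<le> norm g * norm (x - y)"
      using norm_blinfun[of f y] norm_blinfun[of g "x - y"] by auto
    ultimately have "\<bar>blinfun_apply f y\<bar> \<le> norm f * norm x"
      "\<bar>blinfun_apply g (x - y)\<bar> \<le> norm g * norm x"
      by (meson mult_left_mono norm_ge_zero order_trans)+
    then show ?thesis by (simp add: t_def C_def algebra_simps)
  qed
  have bdd: "bdd_above (t x ` {0..x})" for x
    using tb[of _ x] by (intro bdd_aboveI2[where M = "C * norm x"]) (simp add: abs_le_iff)
  define p where "p x = (SUP y\<in>{0..x}. t x y)" for x
  have pu: "t x y \<le> p x" if "0 \<le> y" "y \<le> x" for x y
    unfolding p_def using that by (intro cSUP_upper bdd) auto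
  have pl: "p x \<le> c" if "0 \<le> x" "\<And>y. 0 \<le> y \<Longrightarrow> y \<le> x \<Longrightarrow> t x y \<le> c" for x c
    unfolding p_def using that by (intro cSUP_least) auto
  have ta: "t (x + x') (y + y') = t x y + t x' y'" for x x' y y'
    by (simp add: t_def add_diff_add blinfun.add_right)
  have pa: "p (x + y) = p x + p y" if xy: "0 \<le> x" "0 \<le> y" for x y
  proof (rule order.antisym)
    show "p (x + y) \<le> p x + p y"
    proof (rule pl)
      show "0 \<le> x + y" using xy by simp
      fix z assume z: "0 \<le> z" "z \<le> x + y"
      define u where "u = inf z x"
      have u: "0 \<le> u" "u \<le> x" "u \<le> z" using z xy by (auto simp: u_def)
      have "z - y \<le> u" using z xy by (auto simp: u_def diff_le_eq)
      then have "z - u \<le> y" by (simp add: algebra_simps)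
      then have "t x u + t y (z - u) \<le> p x + p y" using u by (intro add_mono pu) auto
      then show "t (x + y) z \<le> p x + p y" using ta[of x y u "z - u"] by simp
    qed
    have "p x \<le> p (x + y) - p y"
    proof (rule pl[OF xy(1)])
      fix u assume u: "0 \<le> u" "u \<le> x"
      have "p y \<le> p (x + y) - t x u"
      proof (rule pl[OF xy(2)])
        fix v assume v: "0 \<le> v" "v \<le> y"
        have "t (x + y) (u + v) \<le> p (x + y)" using u v by (intro pu add_mono add_nonneg_nonneg)
        then show "t y v \<le> p (x + y) - t x u" by (simp add: ta)
      qed
      then show "t x u \<le> p (x + y) - p y" by simp
    qed
    then show "p x + p y \<le> p (x + y)" by simp
  qed
  have th: "t (c *\<^sub>R x) (c *\<^sub>R y) = c * t x y" for c x y
    by (simp add: t_def blinfun.scaleR_right distrib_left flip: scaleR_diff_right)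
  have ph_ge: "c * p x \<le> p (c *\<^sub>R x)" if "0 < c" "0 \<le> x" for c x
  proof -
    have "p x \<le> p (c *\<^sub>R x) / c"
    proof (rule pl[OF that(2)])
      fix y assume "0 \<le> y" "y \<le> x"
      then have "t (c *\<^sub>R x) (c *\<^sub>R y) \<le> p (c *\<^sub>R x)"
        using that by (intro pu scaleR_nonneg_nonneg scaleR_left_mono) auto
      then show "t x y \<le> p (c *\<^sub>R x) / c" using that by (simp add: th field_simps)
    qed
    then show ?thesis using that by (simp add: field_simps)
  qed
  have ph: "p (c *\<^sub>R x) = c * p x" if "0 < c" "0 \<le> x" for c x
  proof (rule order.antisym)
    have "inverse c * p (c *\<^sub>R x) \<le> p (inverse c *\<^sub>R c *\<^sub>R x)"
      using that by (intro ph_ge scaleR_nonneg_nonneg) auto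
    then show "p (c *\<^sub>R x) \<le> c * p x" using that by (simp add: field_simps)
  qed (use ph_ge that in auto)
  have pb: "\<bar>p x\<bar> \<le> C * norm x" if "0 \<le> x" for x
  proof -
    have "t x 0 \<le> p x" using that by (intro pu) auto
    moreover have "\<bar>t x 0\<bar> \<le> C * norm x" using tb[of 0 x] that by simp
    moreover have "p x \<le> C * norm x" using that tb[of _ x] by (intro pl) (auto simp: abs_le_iff)
    ultimately show ?thesis by linarith
  qed
  obtain h where h: "\<forall>x\<ge>0. blinfun_apply h x = p x"
    using functional_extension[of p C] pa ph pb C by blast
  have "blinfun_apply f x \<le> p x" "blinfun_apply g x \<le> p x" if "0 \<le> x" for x
    using pu[of x x] pu[of 0 x] that by (simp_all add: t_def blinfun.zero_right)
  moreover have "p x \<le> blinfun_apply k x" if "op_le f k" "op_le g k" "0 \<le> x" for k x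
  proof (rule pl[OF that(3)])
    fix y assume "0 \<le> y" "y \<le> x"
    then have "blinfun_apply f y \<le> blinfun_apply k y"
      "blinfun_apply g (x - y) \<le> blinfun_apply k (x - y)"
      using that by (auto simp: op_le_def)
    then show "t x y \<le> blinfun_apply k x" by (simp add: t_def blinfun.diff_right)
  qed
  ultimately show ?thesis using h unfolding op_le_def p_def t_def by (intro exI[of _ h]) auto
qed

lemma dual_sup_eqI:
  assumes "op_le f h" "op_le g h" "\<And>k. op_le f k \<Longrightarrow> op_le g k \<Longrightarrow> op_le h k"
  shows "dual_sup f g = h"
  unfolding dual_sup_def using assms by (intro the_equality) (auto intro: op_le_antisym)

lemma dual_inf_eqI:
  assumes "op_le h f" "op_le h g" "\<And>k. op_le k f \<Longrightarrow> op_le k g \<Longrightarrow> op_le k h"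
  shows "dual_inf f g = h"
  unfolding dual_inf_def using assms by (intro the_equality) (auto intro: op_le_antisym)

lemma dual_sup:
  shows "op_le f (dual_sup f g)" "op_le g (dual_sup f g)"
    and "op_le f k \<Longrightarrow> op_le g k \<Longrightarrow> op_le (dual_sup f g) k"
    and "0 \<le> x \<Longrightarrow> blinfun_apply (dual_sup f g) x =
      (SUP y\<in>{0..x}. blinfun_apply f y + blinfun_apply g (x - y))"
proof -
  obtain h where h: "op_le f h" "op_le g h" "\<And>k. op_le f k \<Longrightarrow> op_le g k \<Longrightarrow> op_le h k"
    "\<And>x. 0 \<le> x \<Longrightarrow> blinfun_apply h x =
      (SUP y\<in>{0..x}. blinfun_apply f y + blinfun_apply g (x - y))"
    using riesz_kantorovich[of f g] by metis
  have "dual_sup f g = h" using h by (intro dual_sup_eqI)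
  then show "op_le f (dual_sup f g)" "op_le g (dual_sup f g)"
    "op_le f k \<Longrightarrow> op_le g k \<Longrightarrow> op_le (dual_sup f g) k"
    "0 \<le> x \<Longrightarrow> blinfun_apply (dual_sup f g) x =
      (SUP y\<in>{0..x}. blinfun_apply f y + blinfun_apply g (x - y))"
    using h by auto
qed

lemma dual_inf_eq: "dual_inf f g = - dual_sup (- f) (- g)"
proof (rule dual_inf_eqI)
  show "op_le (- dual_sup (- f) (- g)) f" "op_le (- dual_sup (- f) (- g)) g"
    using dual_sup(1)[of "- f" "- g"] dual_sup(2)[of "- g" "- f"]
      op_le_uminus[of _ "- f"] op_le_uminus[of _ "- g"] by auto
  fix k assume "op_le k f" "op_le k g"
  then have "op_le (dual_sup (- f) (- g)) (- k)" by (intro dual_sup(3)) (simp_all add: op_le_uminus)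
  then show "op_le k (- dual_sup (- f) (- g))" using op_le_uminus[of "- k"] by simp
qed

lemma dual_inf:
  shows "op_le (dual_inf f g) f" "op_le (dual_inf f g) g"
    and "op_le k f \<Longrightarrow> op_le k g \<Longrightarrow> op_le k (dual_inf f g)"
proof -
  show "op_le (dual_inf f g) f" "op_le (dual_inf f g) g"
    unfolding dual_inf_eq
    using dual_sup(1)[of "- f" "- g"] dual_sup(2)[of "- g" "- f"]
      op_le_uminus[of _ "- f"] op_le_uminus[of _ "- g"] by auto
  assume "op_le k f" "op_le k g"
  then have "op_le (dual_sup (- f) (- g)) (- k)" by (intro dual_sup(3)) (simp_all add: op_le_uminus)
  then show "op_le k (dual_inf f g)" unfolding dual_inf_eq using op_le_uminus[of "- k"] by simp
qed

definition dual_disjoint_seq :: "(nat \<Rightarrow> ('a::banach_lattice \<Rightarrow>\<^sub>L real)) \<Rightarrow> bool"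
  where "dual_disjoint_seq f \<longleftrightarrow>
    (\<forall>n m. n \<noteq> m \<longrightarrow> dual_inf (dual_abs (f n)) (dual_abs (f m)) = 0)"

section \<open>Weak and weak* topologies\<close>

text \<open>The coarsest topology on \<open>'a\<close> making every continuous linear functional continuous:
  \<open>euclidean\<close> on a function type is the topology of pointwise convergence.\<close>

definition weak_topology :: "'a::real_normed_vector topology"
  where "weak_topology =
    pullback_topology UNIV (\<lambda>x (f :: 'a \<Rightarrow>\<^sub>L real). blinfun_apply f x) euclidean"

text \<open>For real-valued functionals the strong operator topology (pointwise convergence) is the
  weak* topology.\<close>

definition weak_star_topology :: "('a::real_normed_vector \<Rightarrow>\<^sub>L real) topology"
  where "weak_star_topology = strong_operator_topology"

definition weak_star_null :: "(nat \<Rightarrow> ('a::real_normed_vector \<Rightarrow>\<^sub>L real)) \<Rightarrow> bool"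
  where "weak_star_null f \<longleftrightarrow> limitin weak_star_topology f 0 sequentially"

definition relatively_weakly_compact :: "'a::real_normed_vector set \<Rightarrow> bool"
  where "relatively_weakly_compact A \<longleftrightarrow>
    compactin weak_topology (weak_topology closure_of A)"

section \<open>Property (d), almost limited sets, weak almost limited operators\<close>

definition property_d :: "'a::banach_lattice itself \<Rightarrow> bool"
  where "property_d _ \<longleftrightarrow>
    (\<forall>f :: nat \<Rightarrow> ('a \<Rightarrow>\<^sub>L real). dual_disjoint_seq f \<and> weak_star_null f \<longrightarrow>
      weak_star_null (\<lambda>n. dual_abs (f n)))"

text \<open>The supremum is taken in \<open>ennreal\<close>, so that it is \<open>0\<close> for the empty set.\<close>

definition almost_limited :: "'a::banach_lattice set \<Rightarrow> bool"
  where "almost_limited A \<longleftrightarrow> bounded A \<and>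
    (\<forall>f :: nat \<Rightarrow> ('a \<Rightarrow>\<^sub>L real). dual_disjoint_seq f \<and> weak_star_null f \<longrightarrow>
      (\<lambda>n. SUP y\<in>A. ennreal \<bar>blinfun_apply (f n) y\<bar>) \<longlonglongrightarrow> 0)"

definition weak_almost_limited :: "('a::banach \<Rightarrow>\<^sub>L 'b::banach_lattice) \<Rightarrow> bool"
  where "weak_almost_limited T \<longleftrightarrow>
    (\<forall>A. relatively_weakly_compact A \<longrightarrow> almost_limited (blinfun_apply T ` A))"

end

theory Submission
  imports Defs
begin

text \<open>
  If \<open>(f\<^sub>n)\<close> is disjoint and weak* null, then by property (d) so is \<open>(|f\<^sub>n|)\<close>, and
  \<open>|f\<^sub>n (S x)| \<le> g\<^sub>n |x|\<close> with \<open>g\<^sub>n = |f\<^sub>n| \<circ> T \<ge> 0\<close>. Since \<open>T\<close> is weak almost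
  limited, \<open>g\<^sub>n\<close> tends to \<open>0\<close> uniformly on every weakly null sequence. If it did not do so on the
  moduli of a relatively weakly compact set \<open>A\<close>, one could extract a disjoint sequence in the solid
  hull of \<open>A\<close> on which \<open>g\<^sub>n\<close> is not uniformly null; but such disjoint sequences are weakly null.
  The latter holds because the components of a positive functional \<open>f\<close> on the bands generated by
  disjoint vectors define an operator into \<open>\<ell>\<^sub>1\<close>, where weakly compact sets are norm compact.
\<close>

section \<open>Hahn--Banach and uniform boundedness\<close>

definition sublinear :: "('a::real_vector \<Rightarrow> real) \<Rightarrow> bool"
  where "sublinear q \<longleftrightarrow>
    (\<forall>x y. q (x + y) \<le> q x + q y) \<and> (\<forall>t\<ge>0. \<forall>x. q (t *\<^sub>R x) = t * q x)"

lemma sublinear_add: "sublinear q \<Longrightarrow> q (x + y) \<le> q x + q y"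
  and sublinear_scaleR: "sublinear q \<Longrightarrow> 0 \<le> t \<Longrightarrow> q (t *\<^sub>R x) = t * q x"
  by (auto simp: sublinear_def)

lemma sublinear_zero: "sublinear q \<Longrightarrow> q 0 = 0"
  using sublinear_scaleR[of q 0 0] by simp

lemma sublinear_minus_ge: "sublinear q \<Longrightarrow> - q x \<le> q (- x)"
  using sublinear_add[of q x "- x"] by (simp add: sublinear_zero)

text \<open>Lowering \<open>q\<close> along the ray spanned by \<open>y\<close> gives the largest
  sublinear functional below \<open>q\<close> whose value at \<open>- y\<close> is at most
  \<open>- q y\<close>. The infimum is finite because \<open>- q (- x)\<close> bounds it from below;
  \<open>t = 0\<close> and \<open>t = 1\<close> give the two inequalities.\<close>

lemma sublinear_improve:
  assumes q: "sublinear q"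
  shows "\<exists>r. sublinear r \<and> (\<forall>x. r x \<le> q x) \<and> r (- y) \<le> - q y"
proof -
  define v where "v x t = q (x + t *\<^sub>R y) - t * q y" for x t
  define r where "r x = (INF t\<in>{0..}. v x t)" for x
  have lb: "- q (- x) \<le> v x t" if "0 \<le> t" for x t
    using sublinear_add[OF q, of "x + t *\<^sub>R y" "- x"] sublinear_scaleR[OF q that, of y]
    by (simp add: v_def)
  then have bdd: "bdd_below (v x ` {0..})" for x
    by (intro bdd_belowI2[where m = "- q (- x)"]) simp
  have ub: "r x \<le> v x t" if "0 \<le> t" for x t
    unfolding r_def using that by (intro cINF_lower bdd) auto
  have glb: "c \<le> r x" if "\<And>t. 0 \<le> t \<Longrightarrow> c \<le> v x t" for c x
    unfolding r_def using that by (intro cINF_greatest) auto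
  have rq: "r x \<le> q x" for x using ub[of 0 x] by (simp add: v_def)
  have add: "r (x + z) \<le> r x + r z" for x z
  proof -
    have "r (x + z) - r x \<le> r z"
    proof (rule glb)
      fix s :: real assume s: "0 \<le> s"
      have "r (x + z) - v z s \<le> r x"
      proof (rule glb)
        fix t :: real assume t: "0 \<le> t"
        have "r (x + z) \<le> v (x + z) (t + s)" using s t by (intro ub) simp
        also have "\<dots> \<le> v x t + v z s"
          using sublinear_add[OF q, of "x + t *\<^sub>R y" "z + s *\<^sub>R y"]
          by (simp add: v_def algebra_simps)
        finally show "r (x + z) - v z s \<le> v x t" by simp
      qed
      then show "r (x + z) - r x \<le> v z s" by simp
    qed
    then show ?thesis by simp
  qed
  have le: "c * r x \<le> r (c *\<^sub>R x)" if c: "0 < c" for c x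
  proof (rule glb)
    fix t :: real assume t: "0 \<le> t"
    have "c *\<^sub>R x + t *\<^sub>R y = c *\<^sub>R (x + (t / c) *\<^sub>R y)" using c by (simp add: scaleR_add_right)
    then have "v (c *\<^sub>R x) t = c * v x (t / c)"
      using c sublinear_scaleR[OF q, of c] by (simp add: v_def right_diff_distrib)
    then show "c * r x \<le> v (c *\<^sub>R x) t" using ub[of "t / c" x] c t by simp
  qed
  have "r (c *\<^sub>R x) = c * r x" if "0 \<le> c" for c x
  proof (cases "c = 0")
    case True
    then show ?thesis
      using rq[of 0] glb[of 0 0] lb[of _ 0] sublinear_zero[OF q] by simp
  next
    case False
    then have c: "0 < c" using that by simp
    have "inverse c * r (c *\<^sub>R x) \<le> r x" using le[of "inverse c" "c *\<^sub>R x"] c by simp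
    then have "r (c *\<^sub>R x) \<le> c * r x" using c by (simp add: field_simps)
    then show ?thesis using le[OF c, of x] by simp
  qed
  then have "sublinear r" using add by (simp add: sublinear_def)
  moreover have "r (- y) \<le> - q y" using ub[of 1 "- y"] sublinear_zero[OF q] by (simp add: v_def)
  ultimately show ?thesis using rq by blast
qed

text \<open>Hahn--Banach: a sublinear functional that is minimal for the pointwise order is linear,
  because \<open>sublinear_improve\<close> cannot make it smaller.\<close>

theorem exists_norming_functional:
  fixes x0 :: "'a::real_normed_vector"
  shows "\<exists>f :: 'a \<Rightarrow>\<^sub>L real. norm f \<le> 1 \<and> blinfun_apply f x0 = norm x0"
proof -
  \<comment> \<open>Once the minimal functional is known to be odd, the condition at
    \<open>- x0\<close> reads \<open>norm x0 <= m x0\<close>.\<close>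
  define Q where "Q = {q :: 'a \<Rightarrow> real. sublinear q \<and> (\<forall>x. q x \<le> norm x) \<and> q (- x0) \<le> - norm x0}"
  \<comment> \<open>The smaller functional stands last in \<open>P\<close>, so a maximal element in
    the sense of Zorn's lemma is pointwise minimal.\<close>
  define P where "P q r \<longleftrightarrow> (\<forall>x. r x \<le> q x)" for q r :: "'a \<Rightarrow> real"
  have "sublinear (norm :: 'a \<Rightarrow> real)" by (simp add: sublinear_def norm_triangle_ineq)
  then obtain p where p: "p \<in> Q" using sublinear_improve[of norm x0] by (auto simp: Q_def)
  have "\<exists>m\<in>Q. \<forall>a\<in>Q. P m a \<longrightarrow> a = m"
  proof (rule predicate_Zorn)
    show "partial_order_on Q (relation_of P Q)"
      by (rule partial_order_on_relation_ofI)
        (auto simp: P_def fun_eq_iff intro: order.antisym order_trans)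
    fix C assume C: "C \<in> Chains (relation_of P Q)"
    then have CQ: "C \<subseteq> Q" and tot: "\<And>a b. a \<in> C \<Longrightarrow> b \<in> C \<Longrightarrow> P a b \<or> P b a"
      by (auto simp: Chains_def relation_of_def)
    show "\<exists>u\<in>Q. \<forall>a\<in>C. P a u"
    proof (cases "C = {}")
      case True
      then show ?thesis using p by auto
    next
      case ne: False
      define u where "u x = (INF a\<in>C. a x)" for x
      have sub: "sublinear a" and le: "a x \<le> norm x" and x0: "a (- x0) \<le> - norm x0"
        if "a \<in> C" for a x
        using that CQ by (auto simp: Q_def)
      have "- norm x \<le> a x" if "a \<in> C" for a x
        using sublinear_minus_ge[OF sub[OF that], of x] le[OF that, of "- x"] by simp
      then have bdd: "bdd_below ((\<lambda>a. a x) ` C)" for x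
        by (intro bdd_belowI2[where m = "- norm x"])
      have ub: "u x \<le> a x" if "a \<in> C" for a x
        unfolding u_def using that by (intro cINF_lower bdd)
      have glb: "c \<le> u x" if "\<And>a. a \<in> C \<Longrightarrow> c \<le> a x" for c x
        unfolding u_def using ne that by (intro cINF_greatest)
      have add: "u (x + y) \<le> u x + u y" for x y
      proof -
        have "u (x + y) - u x \<le> u y"
        proof (rule glb)
          fix a assume a: "a \<in> C"
          have "u (x + y) - a y \<le> u x"
          proof (rule glb)
            fix b assume b: "b \<in> C"
            \<comment> \<open>In a chain the smaller of \<open>a\<close> and \<open>b\<close> lies
              below both, so its subadditivity serves both arguments.\<close>
            obtain c where c: "c \<in> C" "\<And>z. c z \<le> a z" "\<And>z. c z \<le> b z"
              using tot[OF a b] a b unfolding P_def by (metis order_refl)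
            have "u (x + y) \<le> c x + c y"
              using ub[OF c(1), of "x + y"] sublinear_add[OF sub[OF c(1)], of x y] by simp
            then show "u (x + y) - a y \<le> b x" using c(2)[of y] c(3)[of x] by simp
          qed
          then show "u (x + y) - u x \<le> a y" by simp
        qed
        then show ?thesis by simp
      qed
      have scale: "u (t *\<^sub>R x) = t * u x" if t: "0 \<le> t" for t x
      proof (cases "t = 0")
        case True
        have "u 0 = (INF a\<in>C. 0)"
          unfolding u_def using sublinear_zero[OF sub] by (intro INF_cong) auto
        then show ?thesis using True ne by simp
      next
        case False
        show ?thesis
        proof (rule order.antisym)
          have "u (t *\<^sub>R x) / t \<le> u x"
            using ub[of _ "t *\<^sub>R x"] sublinear_scaleR[OF sub t] t False
            by (intro glb) (simp add: field_simps)
          then show "u (t *\<^sub>R x) \<le> t * u x" using t False by (simp add: field_simps)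
          show "t * u x \<le> u (t *\<^sub>R x)"
          proof (rule glb)
            fix a assume a: "a \<in> C"
            show "t * u x \<le> a (t *\<^sub>R x)"
              using mult_left_mono[OF ub[OF a, of x] t] sublinear_scaleR[OF sub[OF a] t] by simp
          qed
        qed
      qed
      obtain a where a: "a \<in> C" using ne by auto
      have "u \<in> Q"
        using add scale order_trans[OF ub[OF a] le[OF a]] order_trans[OF ub[OF a] x0[OF a]]
        unfolding Q_def sublinear_def by auto
      then show ?thesis using ub by (auto simp: P_def)
    qed
  qed
  then obtain m where m: "m \<in> Q" "\<And>a. a \<in> Q \<Longrightarrow> (\<And>x. a x \<le> m x) \<Longrightarrow> a = m"
    unfolding P_def by blast
  have sub: "sublinear m" and le: "\<And>x. m x \<le> norm x" and mx0: "m (- x0) \<le> - norm x0"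
    using m(1) by (auto simp: Q_def)
  have odd: "m (- y) = - m y" for y
  proof -
    obtain r where r: "sublinear r" "\<And>x. r x \<le> m x" "r (- y) \<le> - m y"
      using sublinear_improve[OF sub, of y] by blast
    have "r \<in> Q" using r le mx0 unfolding Q_def by (auto intro: order_trans)
    then have "r = m" using m(2) r(2) by blast
    then show ?thesis using r(3) sublinear_minus_ge[OF sub, of y] by simp
  qed
  have add: "m (x + y) = m x + m y" for x y
    using sublinear_add[OF sub, of x y] sublinear_add[OF sub, of "- x" "- y"] odd[of "x + y"]
    by (simp add: odd)
  have scale: "m (c *\<^sub>R x) = c * m x" for c x
    using sublinear_scaleR[OF sub, of c x] sublinear_scaleR[OF sub, of "- c" x] odd[of "c *\<^sub>R x"]
    by (cases "0 \<le> c") auto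
  have bound: "\<bar>m x\<bar> \<le> norm x" for x using le[of x] le[of "- x"] odd[of x] by simp
  have "bounded_linear m"
    by (rule bounded_linear_intro[where K = 1]) (auto simp: add scale bound)
  then have ap: "blinfun_apply (Blinfun m) = m" by (rule bounded_linear_Blinfun_apply)
  have "norm (Blinfun m) \<le> 1"
    using bound by (intro norm_blinfun_bound) (auto simp: ap)
  moreover have "m x0 = norm x0" using mx0 le[of x0] odd[of x0] by simp
  ultimately show ?thesis using ap by (intro exI[of _ "Blinfun m"]) simp
qed

text \<open>A gliding hump in the dual, which is complete even if the space is not. A series of
  terms of norm at most \<open>3 ^ (- n)\<close> is built from norming functionals of points with
  \<open>4 ^ n <= norm (x n)\<close>. The tail after term \<open>n\<close> has norm at most half of
  \<open>3 ^ (- n)\<close>, so the sum is at least half of \<open>(4 / 3) ^ n\<close> in modulus at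
  \<open>x n\<close>.\<close>

theorem weakly_bounded_imp_bounded:
  fixes A :: "'a::real_normed_vector set"
  assumes "\<And>f :: 'a \<Rightarrow>\<^sub>L real. bounded (blinfun_apply f ` A)"
  shows "bounded A"
proof (rule ccontr)
  assume "\<not> bounded A"
  then have "\<exists>x\<in>A. 4 ^ n \<le> norm x" for n :: nat
    by (metis bounded_iff linear)
  then obtain x where x: "\<And>n::nat. x n \<in> A" "\<And>n. 4 ^ n \<le> norm (x n)" by metis
  obtain \<phi> :: "nat \<Rightarrow> ('a \<Rightarrow>\<^sub>L real)"
    where \<phi>: "\<And>n. norm (\<phi> n) \<le> 1" "\<And>n. blinfun_apply (\<phi> n) (x n) = norm (x n)"
    using exists_norming_functional[of "x _"] by metis
  \<comment> \<open>The sign of the preceding partial sum at \<open>x n\<close> is given to the n-th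
    term, so that the two moduli add up and never cancel.\<close>
  define s where "s h y = (if 0 \<le> blinfun_apply h y then 1 else - 1 :: real)" 
    for h :: "'a \<Rightarrow>\<^sub>L real" and y
  define F where "F = rec_nat 0 (\<lambda>n h. h + (s h (x n) * (1 / 3) ^ n) *\<^sub>R \<phi> n)"
  define d where "d n = F (Suc n) - F n" for n
  have F: "F (Suc n) = F n + (s (F n) (x n) * (1 / 3) ^ n) *\<^sub>R \<phi> n" for n by (simp add: F_def)
  have nd: "norm (d n) \<le> (1 / 3) ^ n" for n
    using \<phi>(1)[of n] by (simp add: d_def F s_def abs_mult mult_left_le)
  have F0: "F 0 = 0" by (simp add: F_def)
  have geo: "summable (\<lambda>n. (1 / 3 :: real) ^ n)" by (rule summable_geometric) simp
  have sd: "summable d" by (rule summable_norm_cancel, rule summable_comparison_test'[OF geo]) (simp add: nd)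
  define f where "f = suminf d"
  have Fd: "F n = (\<Sum>i<n. d i)" for n by (induction n) (auto simp: F0 d_def)
  have near: "norm (f - F (Suc n)) \<le> (1 / 3) ^ n / 2" for n
  proof -
    have "f - F (Suc n) = (\<Sum>i. d (i + Suc n))"
      using suminf_split_initial_segment[OF sd, of "Suc n"] by (simp add: f_def Fd)
    also have "norm \<dots> \<le> (\<Sum>i. (1 / 3) ^ Suc n * (1 / 3) ^ i)"
    proof (rule norm_suminf_le)
      show "norm (d (i + Suc n)) \<le> (1 / 3) ^ Suc n * (1 / 3) ^ i" for i
        using nd[of "i + Suc n"] by (simp add: power_add mult.commute)
    qed (intro summable_mult geo)
    also have "\<dots> = (1 / 3) ^ n / 2"
      by (subst suminf_mult[OF geo]) (simp add: suminf_geometric)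
    finally show ?thesis .
  qed
  have big: "(4 / 3) ^ n / 2 \<le> \<bar>blinfun_apply f (x n)\<bar>" for n
  proof -
    have nonneg: "0 \<le> (1 / 3) ^ n * norm (x n)" by simp
    have "\<bar>blinfun_apply (F (Suc n)) (x n)\<bar>
        = \<bar>blinfun_apply (F n) (x n)\<bar> + (1 / 3) ^ n * norm (x n)"
    proof (cases "0 \<le> blinfun_apply (F n) (x n)")
      case True
      then show ?thesis using nonneg by (simp add: F s_def \<phi> blinfun.add_left blinfun.scaleR_left)
    next
      case False
      then have "blinfun_apply (F n) (x n) - (1 / 3) ^ n * norm (x n) < 0"
        using nonneg by linarith
      then show ?thesis using abs_of_neg False by (simp add: F s_def \<phi> blinfun.diff_left blinfun.scaleR_left)
    qed
    moreover have "\<bar>blinfun_apply (f - F (Suc n)) (x n)\<bar> \<le> (1 / 3) ^ n / 2 * norm (x n)"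
      using norm_blinfun[of "f - F (Suc n)" "x n"] mult_right_mono[OF near, of "norm (x n)" n]
      by simp
    ultimately have "(1 / 3) ^ n * norm (x n) / 2 \<le> \<bar>blinfun_apply f (x n)\<bar>"
      using abs_ge_zero[of "blinfun_apply (F n) (x n)"]
        abs_triangle_ineq3[of "blinfun_apply f (x n)" "blinfun_apply (F (Suc n)) (x n)"]
      unfolding blinfun.diff_left abs_le_iff by linarith
    moreover have "(4 / 3) ^ n \<le> (1 / 3) ^ n * norm (x n)"
      using mult_left_mono[OF x(2)[of n], of "(1 / 3) ^ n"] by (simp add: power_divide)
    ultimately show ?thesis by simp
  qed
  obtain B where "\<And>n. \<bar>blinfun_apply f (x n)\<bar> \<le> B"
    using assms[of f] x(1) unfolding bounded_iff by auto
  then have "(4 / 3) ^ n \<le> 2 * B" for n using big[of n] by (smt (verit) field_sum_of_halves)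
  moreover obtain n where "2 * B < (4 / 3) ^ n" using real_arch_pow[of "4 / 3"] by auto
  ultimately show False by (meson not_le)
qed

section \<open>Weakly compact sets\<close>

lemma topspace_weak_topology [simp]: "topspace weak_topology = UNIV"
  by (simp add: weak_topology_def topspace_pullback_topology)

lemma continuous_map_weak_evaluation:
  "continuous_map weak_topology euclidean (\<lambda>x (f :: 'a::real_normed_vector \<Rightarrow>\<^sub>L real). blinfun_apply f x)"
  using continuous_map_pullback[OF continuous_map_id, of UNIV _ euclidean]
  by (simp add: weak_topology_def o_def)

text \<open>Norming functionals separate points, so the space embeds in a product of lines.\<close>

lemma Hausdorff_space_weak_topology:
  "Hausdorff_space (weak_topology :: 'a::real_normed_vector topology)"
proof (rule Hausdorff_space_injective_preimage[OF _ continuous_map_weak_evaluation])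
  show "Hausdorff_space (euclidean :: (('a \<Rightarrow>\<^sub>L real) \<Rightarrow> real) topology)"
    by (simp add: Hausdorff_space_product_topology flip: euclidean_product_topology)
  show "inj_on (\<lambda>x (f :: 'a \<Rightarrow>\<^sub>L real). blinfun_apply f x) (topspace weak_topology)"
  proof (rule inj_onI)
    fix x y :: 'a
    assume "(\<lambda>f :: 'a \<Rightarrow>\<^sub>L real. blinfun_apply f x) = (\<lambda>f. blinfun_apply f y)"
    then have "blinfun_apply f (x - y) = 0" for f :: "'a \<Rightarrow>\<^sub>L real"
      by (simp add: fun_eq_iff blinfun.diff_right)
    then show "x = y" using exists_norming_functional[of "x - y"] by (metis eq_iff_diff_eq_0 norm_eq_zero)
  qed
qed

lemma limitin_pullback_topology:
  "limitin (pullback_topology UNIV e T) f l F \<longleftrightarrow> limitin T (\<lambda>x. e (f x)) (e l) F"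
  by (auto simp: limitin_def openin_pullback_topology topspace_pullback_topology)

lemma tendsto_fun_iff:
  fixes f :: "'i \<Rightarrow> 'a \<Rightarrow> real"
  shows "(f \<longlongrightarrow> l) F \<longleftrightarrow> (\<forall>x. ((\<lambda>i. f i x) \<longlongrightarrow> l x) F)"
  using limitin_componentwise[of "\<lambda>_. euclidean" UNIV f l F] by (simp add: euclidean_product_topology)

lemma weak_star_null_iff: "weak_star_null f \<longleftrightarrow> (\<forall>x. (\<lambda>n. blinfun_apply (f n) x) \<longlonglongrightarrow> 0)"
  by (simp add: weak_star_null_def weak_star_topology_def strong_operator_topology_def
      limitin_pullback_topology tendsto_fun_iff)

lemma limitin_weak_topology_iff:
  fixes x :: "'i \<Rightarrow> 'a::real_normed_vector"
  shows "limitin weak_topology x l F \<longleftrightarrow>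
    (\<forall>f :: 'a \<Rightarrow>\<^sub>L real. ((\<lambda>n. blinfun_apply f (x n)) \<longlongrightarrow> blinfun_apply f l) F)"
  by (simp add: weak_topology_def limitin_pullback_topology tendsto_fun_iff)

text \<open>The filter \<open>G\<close> plays the role of a subnet.\<close>

lemma relatively_weakly_compact_cluster:
  fixes K :: "'a::real_normed_vector set"
  assumes K: "relatively_weakly_compact K" and y: "\<And>n::nat. y n \<in> K"
  obtains G l where "G \<noteq> bot" "G \<le> sequentially"
    "\<And>f :: 'a \<Rightarrow>\<^sub>L real. ((\<lambda>n. blinfun_apply f (y n)) \<longlongrightarrow> blinfun_apply f l) G"
proof -
  \<comment> \<open>Evaluation carries weak compactness to the function space with its product
    topology, where \<open>compact_filter\<close> yields cluster points.\<close>
  define ev where "ev x = (\<lambda>f :: 'a \<Rightarrow>\<^sub>L real. blinfun_apply f x)" for x :: 'a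
  have "compactin euclidean (ev ` (weak_topology closure_of K))"
    using image_compactin[OF K[unfolded relatively_weakly_compact_def] continuous_map_weak_evaluation]
    by (simp add: ev_def[abs_def])
  then have C: "compact (ev ` (weak_topology closure_of K))" by simp
  have y': "y n \<in> weak_topology closure_of K" for n
    using closure_of_subset[of K weak_topology] y by auto
  let ?F = "filtermap (\<lambda>n. ev (y n)) sequentially"
  have "?F \<noteq> bot" by (simp add: filtermap_bot_iff)
  moreover have "eventually (\<lambda>c. c \<in> ev ` (weak_topology closure_of K)) ?F"
    using y' by (simp add: eventually_filtermap)
  ultimately obtain c where c: "c \<in> ev ` (weak_topology closure_of K)" "inf (nhds c) ?F \<noteq> bot"
    using C unfolding compact_filter by meson
  then obtain l where l: "c = ev l" by auto
  \<comment> \<open>\<open>G\<close> consists of large indices at which the sequence is near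
    \<open>c\<close>. It is proper because \<open>c\<close> is a cluster point of the image
    filter.\<close>
  define G where "G = inf (filtercomap (\<lambda>n. ev (y n)) (nhds c)) sequentially"
  have "G \<noteq> bot"
  proof
    assume "G = bot"
    then have "eventually (\<lambda>_. False) G" by simp
    then obtain P Q where PQ: "eventually P (filtercomap (\<lambda>n. ev (y n)) (nhds c))"
      "eventually Q sequentially" "\<And>n. P n \<Longrightarrow> \<not> Q n"
      unfolding G_def eventually_inf by auto
    then obtain R where R: "eventually R (nhds c)" "\<And>n. R (ev (y n)) \<Longrightarrow> P n"
      unfolding eventually_filtercomap by auto
    have "eventually (\<lambda>z. \<not> R z) ?F"
      unfolding eventually_filtermap using PQ(2) by (rule eventually_mono) (use PQ(3) R(2) in auto)
    then have "eventually (\<lambda>_. False) (inf (nhds c) ?F)"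
      using R(1) unfolding eventually_inf by blast
    then show False using c(2) by (simp add: trivial_limit_def)
  qed
  moreover have "G \<le> sequentially" by (simp add: G_def)
  moreover have "((\<lambda>n. ev (y n)) \<longlongrightarrow> c) G"
    unfolding G_def by (rule tendsto_mono[OF inf_le1 filterlim_filtercomap])
  then have "((\<lambda>n. blinfun_apply f (y n)) \<longlongrightarrow> blinfun_apply f l) G" for f :: "'a \<Rightarrow>\<^sub>L real"
    by (simp add: tendsto_fun_iff l ev_def)
  ultimately show ?thesis by (rule that)
qed

text \<open>Functionals are weakly continuous, so they map the weak closure to compact sets of
  reals, and weakly bounded sets are bounded.\<close>

lemma relatively_weakly_compact_imp_bounded:
  fixes A :: "'a::real_normed_vector set"
  assumes "relatively_weakly_compact A"
  shows "bounded A"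
proof (rule weakly_bounded_imp_bounded)
  fix f :: "'a \<Rightarrow>\<^sub>L real"
  have "continuous_map weak_topology euclidean (blinfun_apply f)"
    using continuous_map_compose[OF continuous_map_weak_evaluation, of euclidean "\<lambda>v. v f"]
    by (simp add: o_def continuous_map_iff_continuous2)
  then have "compact (blinfun_apply f ` (weak_topology closure_of A))"
    using image_compactin[OF assms[unfolded relatively_weakly_compact_def]] by fastforce
  moreover have "A \<subseteq> weak_topology closure_of A" by (simp add: closure_of_subset)
  ultimately show "bounded (blinfun_apply f ` A)"
    by (meson bounded_subset compact_imp_bounded image_mono)
qed

text \<open>This turns a weakly null sequence into a set on which a weak almost limited operator can
  be tested. A convergent sequence with its limit is compact, hence closed in a Hausdorff space, and
  is its own closure.\<close>

lemma relatively_weakly_compact_weakly_null: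
  fixes z :: "nat \<Rightarrow> 'a::real_normed_vector"
  assumes "\<And>f :: 'a \<Rightarrow>\<^sub>L real. (\<lambda>n. blinfun_apply f (z n)) \<longlonglongrightarrow> 0"
  shows "relatively_weakly_compact (insert 0 (range z))"
proof -
  have "limitin weak_topology z 0 sequentially"
    using assms by (simp add: limitin_weak_topology_iff blinfun.zero_right)
  then have c: "compactin weak_topology (insert 0 (range z))"
    by (rule compactin_sequence_with_limit) auto
  then have "closedin weak_topology (insert 0 (range z))"
    by (rule compactin_imp_closedin[OF Hausdorff_space_weak_topology])
  then show ?thesis using c by (simp add: relatively_weakly_compact_def closure_of_closedin)
qed

section \<open>Schur's theorem for sequences of functionals with an l1 bound\<close>

lemma sum_subsequence_le:
  fixes I :: "nat set" and a :: "nat \<Rightarrow> 'a \<Rightarrow> real"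
  assumes "\<And>z I. finite I \<Longrightarrow> (\<Sum>n\<in>I. a n z) \<le> B z" and "strict_mono (r :: nat \<Rightarrow> nat)" and "finite I"
  shows "(\<Sum>n\<in>I. a (r n) z) \<le> B z"
proof -
  have "(\<Sum>n\<in>I. a (r n) z) = (\<Sum>n\<in>r ` I. a n z)"
    using strict_mono_imp_inj_on[OF assms(2)] by (subst sum.reindex) (auto simp: inj_on_def)
  then show ?thesis using assms(1,3) by simp
qed

text \<open>A form of Schur's theorem: \<open>z \<mapsto> (h\<^sub>n z)\<^sub>n\<close> maps into \<open>\<ell>\<^sub>1\<close>, where weakly compact sets
  are norm compact. The gliding hump is summed into the single functional \<open>H\<close>.\<close>

lemma l1_functionals_null_on_weakly_compact_aux:
  fixes h :: "nat \<Rightarrow> ('a::real_normed_vector \<Rightarrow>\<^sub>L real)"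
  assumes h: "\<And>z I. finite I \<Longrightarrow> (\<Sum>n\<in>I. \<bar>blinfun_apply (h n) z\<bar>) \<le> C * norm z"
    and K: "relatively_weakly_compact K" and y: "\<And>n. y n \<in> K"
    and \<epsilon>: "0 < \<epsilon>" "\<And>n. \<epsilon> \<le> \<bar>blinfun_apply (h n) (y n)\<bar>"
  shows False
proof -
  have sm: "summable (\<lambda>n. \<bar>blinfun_apply (h n) z\<bar>)" for z
    using h by (intro summableI_nonneg_bounded[where x = "C * norm z"]) auto
  obtain G l where G: "G \<noteq> bot" "G \<le> sequentially"
    "\<And>f :: 'a \<Rightarrow>\<^sub>L real. ((\<lambda>n. blinfun_apply f (y n)) \<longlongrightarrow> blinfun_apply f l) G"
    using relatively_weakly_compact_cluster[where y = y, OF K y] by blast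
  \<comment> \<open>\<open>n\<close> follows \<open>p\<close> if the coordinates of
    \<open>y n - l\<close> up to \<open>p\<close> are small (weak convergence along
    \<open>G\<close>), the coordinates of \<open>y p - l\<close> from \<open>n\<close> on are small
    (summability), and \<open>h n\<close> is small at \<open>l\<close>. The factor
    \<open>1 / Suc j\<close> later makes each fixed coordinate tend to 0.\<close>
  define Q where "Q j p n \<longleftrightarrow> p < n
    \<and> (\<Sum>i\<le>p. \<bar>blinfun_apply (h i) (y n - l)\<bar>) < \<epsilon> / 8 / real (Suc j)
    \<and> (\<Sum>m. \<bar>blinfun_apply (h (m + n)) (y p - l)\<bar>) < \<epsilon> / 8
    \<and> \<bar>blinfun_apply (h n) l\<bar> < \<epsilon> / 4" for j p n
  have "\<exists>n. Q j p n" for j p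
  proof -
    have "((\<lambda>n. \<Sum>i\<le>p. \<bar>blinfun_apply (h i) (y n - l)\<bar>) \<longlongrightarrow> (\<Sum>i\<le>p. \<bar>0\<bar>)) G"
      using G(3) by (intro tendsto_sum tendsto_rabs) (simp add: blinfun.diff_right LIM_zero)
    then have "eventually (\<lambda>n. (\<Sum>i\<le>p. \<bar>blinfun_apply (h i) (y n - l)\<bar>) < \<epsilon> / 8 / real (Suc j)) G"
      by (rule order_tendstoD(2)) (use \<epsilon> in simp)
    moreover have "eventually (\<lambda>n. p < n \<and> (\<Sum>m. \<bar>blinfun_apply (h (m + n)) (y p - l)\<bar>) < \<epsilon> / 8
      \<and> \<bar>blinfun_apply (h n) l\<bar> < \<epsilon> / 4) sequentially"
    proof (intro eventually_conj)
      obtain N where "\<And>n. n \<ge> N \<Longrightarrow> norm (\<Sum>m. \<bar>blinfun_apply (h (m + n)) (y p - l)\<bar>) < \<epsilon> / 8"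
        using suminf_exist_split[OF _ sm, of "\<epsilon> / 8" "y p - l"] \<epsilon> by auto
      then show "eventually (\<lambda>n. (\<Sum>m. \<bar>blinfun_apply (h (m + n)) (y p - l)\<bar>) < \<epsilon> / 8) sequentially"
        unfolding eventually_sequentially by (metis abs_less_iff real_norm_def)
      show "eventually (\<lambda>n. \<bar>blinfun_apply (h n) l\<bar> < \<epsilon> / 4) sequentially"
        by (rule order_tendstoD(2)[OF summable_LIMSEQ_zero[OF sm]]) (use \<epsilon> in simp)
    qed (rule eventually_gt_at_top)
    then have "eventually (\<lambda>n. p < n \<and> (\<Sum>m. \<bar>blinfun_apply (h (m + n)) (y p - l)\<bar>) < \<epsilon> / 8
      \<and> \<bar>blinfun_apply (h n) l\<bar> < \<epsilon> / 4) G"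
      using G(2) by (rule filter_leD[rotated])
    ultimately have "eventually (Q j p) G" unfolding Q_def by eventually_elim auto
    then show ?thesis using G(1) eventually_happens by blast
  qed
  then obtain s where s: "\<And>j. Q j (s j) (s (Suc j))"
    using dependent_nat_choice[of "\<lambda>_ _. True" Q] by auto
  define k where "k j = s (Suc j)" for j
  have ss: "strict_mono s" using s unfolding Q_def by (intro strict_monoI_Suc) auto
  then have sk: "strict_mono k" by (simp add: k_def strict_mono_def)
  have skab: "summable (\<lambda>j. \<bar>blinfun_apply (h (k j)) z\<bar>)" for z
  proof (rule summableI_nonneg_bounded)
    show "(\<Sum>j<N. \<bar>blinfun_apply (h (k j)) z\<bar>) \<le> C * norm z" for N :: nat
      using sum_subsequence_le[where a = "\<lambda>n z. \<bar>blinfun_apply (h n) z\<bar>", OF h sk, of "{..<N}"] by simp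
  qed simp
  have skm: "summable (\<lambda>j. blinfun_apply (h (k j)) z)" for z
    by (rule summable_rabs_cancel[OF skab])
  define H where "H z = (\<Sum>j. blinfun_apply (h (k j)) z)" for z
  have "bounded_linear H"
  proof (rule bounded_linear_intro[where K = C])
    show "H (x + z) = H x + H z" for x z
      by (simp add: H_def blinfun.add_right suminf_add[OF skm skm])
    show "H (c *\<^sub>R x) = c *\<^sub>R H x" for c x
      by (simp add: H_def blinfun.scaleR_right suminf_mult[OF skm])
    show "norm (H x) \<le> norm x * C" for x
    proof -
      have "\<bar>H x\<bar> \<le> (\<Sum>j. \<bar>blinfun_apply (h (k j)) x\<bar>)" unfolding H_def by (rule summable_rabs[OF skab])
      also have "\<dots> \<le> C * norm x"
      proof (rule suminf_le_const[OF skab])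
        show "(\<Sum>j<N. \<bar>blinfun_apply (h (k j)) x\<bar>) \<le> C * norm x" for N :: nat
          using sum_subsequence_le[where a = "\<lambda>n z. \<bar>blinfun_apply (h n) z\<bar>", OF h sk, of "{..<N}"] by simp
      qed
      finally show ?thesis by (simp add: mult.commute)
    qed
  qed
  then have HB: "blinfun_apply (Blinfun H) = H" by (rule bounded_linear_Blinfun_apply)
  \<comment> \<open>Since \<open>k j = s (Suc j)\<close>, the first \<open>Suc j\<close> values of
    \<open>s\<close> contain all \<open>k i\<close> with \<open>i < j\<close>.\<close>
  have small: "(\<Sum>i<Suc j. \<bar>blinfun_apply (h (s i)) (y (k j) - l)\<bar>) < \<epsilon> / 8 / real (Suc j)" for j
  proof -
    have "(\<Sum>i<Suc j. \<bar>blinfun_apply (h (s i)) (y (k j) - l)\<bar>)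
        = (\<Sum>n\<in>s ` {..<Suc j}. \<bar>blinfun_apply (h n) (y (k j) - l)\<bar>)"
      using strict_mono_imp_inj_on[OF ss] by (subst sum.reindex) (auto simp: inj_on_def)
    also have "\<dots> \<le> (\<Sum>i\<le>s j. \<bar>blinfun_apply (h i) (y (k j) - l)\<bar>)"
      using ss by (intro sum_mono2) (auto simp: strict_mono_less_eq)
    also have "\<dots> < \<epsilon> / 8 / real (Suc j)" using s[of j] by (simp add: Q_def k_def)
    finally show ?thesis .
  qed
  \<comment> \<open>The hump at \<open>j\<close> is at least
    \<open>\<epsilon> - \<epsilon> / 4\<close>; the coordinates before it and those after it
    contribute less than \<open>\<epsilon> / 8\<close> each.\<close>
  have big: "\<epsilon> / 2 \<le> \<bar>H (y (k j) - l)\<bar>" for j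
  proof -
    let ?a = "\<lambda>i. blinfun_apply (h (k i)) (y (k j) - l)"
    have "\<bar>\<Sum>i<j. ?a i\<bar> \<le> (\<Sum>i<j. \<bar>?a i\<bar>)" by (rule sum_abs)
    also have "\<dots> \<le> (\<Sum>i<Suc j. \<bar>blinfun_apply (h (s i)) (y (k j) - l)\<bar>)"
      unfolding k_def sum.lessThan_Suc_shift by simp
    also have "\<dots> < \<epsilon> / 8 / real (Suc j)" by (rule small)
    also have "\<dots> \<le> \<epsilon> / 8" using \<epsilon>(1) by (simp add: field_simps)
    finally have 1: "\<bar>\<Sum>i<j. ?a i\<bar> < \<epsilon> / 8" .
    let ?m = "s (Suc (Suc j))"
    have shift: "summable (\<lambda>i. \<bar>?a (i + Suc j)\<bar>)" by (rule summable_ignore_initial_segment[OF skab])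
    have "\<bar>\<Sum>i. ?a (i + Suc j)\<bar> \<le> (\<Sum>i. \<bar>?a (i + Suc j)\<bar>)" by (rule summable_rabs[OF shift])
    also have "\<dots> \<le> (\<Sum>m. \<bar>blinfun_apply (h (m + ?m)) (y (k j) - l)\<bar>)"
    proof (rule suminf_le_const[OF shift])
      fix N
      \<comment> \<open>All later indices \<open>k (i + Suc j)\<close> are at least
        \<open>?m\<close>. Shifted by \<open>?m\<close> they are distinct, so their sum is part of
        the tail made small by \<open>Q\<close>.\<close>
      define r where "r i = k (i + Suc j) - ?m" for i
      have kr: "k (i + Suc j) = r i + ?m" for i
        using strict_mono_less_eq[OF ss, of "Suc (Suc j)" "Suc (i + Suc j)"] by (simp add: r_def k_def)
      have "inj r"
      proof (rule injI)
        fix i i' assume "r i = r i'"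
        then have "k (i + Suc j) = k (i' + Suc j)" unfolding kr by simp
        then show "i = i'" using strict_mono_eq[OF sk] by simp
      qed
      then have "(\<Sum>i<N. \<bar>?a (i + Suc j)\<bar>)
          = (\<Sum>m\<in>r ` {..<N}. \<bar>blinfun_apply (h (m + ?m)) (y (k j) - l)\<bar>)"
        by (subst sum.reindex) (auto simp: inj_on_def simp flip: kr)
      also have "\<dots> \<le> (\<Sum>m. \<bar>blinfun_apply (h (m + ?m)) (y (k j) - l)\<bar>)"
        by (intro sum_le_suminf summable_ignore_initial_segment[OF sm]) auto
      finally show "(\<Sum>i<N. \<bar>?a (i + Suc j)\<bar>) \<le> (\<Sum>m. \<bar>blinfun_apply (h (m + ?m)) (y (k j) - l)\<bar>)" .
    qed
    also have "\<dots> < \<epsilon> / 8" using s[of "Suc j"] by (simp add: Q_def k_def)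
    finally have 2: "\<bar>\<Sum>i. ?a (i + Suc j)\<bar> < \<epsilon> / 8" .
    have 3: "3 * \<epsilon> / 4 \<le> \<bar>?a j\<bar>"
      using \<epsilon>(2)[of "k j"] s[of j]
        abs_triangle_ineq2[of "blinfun_apply (h (k j)) (y (k j))" "blinfun_apply (h (k j)) l"]
      unfolding Q_def k_def blinfun.diff_right by linarith
    have "H (y (k j) - l) = (\<Sum>i. ?a (i + Suc j)) + ((\<Sum>i<j. ?a i) + ?a j)"
      unfolding H_def using suminf_split_initial_segment[OF skm, of _ "Suc j"] by simp
    then show ?thesis using 1 2 3 \<epsilon>(1) by linarith
  qed
  \<comment> \<open>\<open>G\<close> may miss the indices \<open>k n\<close>, so a second cluster
    point is taken along the subsequence. It agrees with \<open>l\<close> under every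
    \<open>h (k i)\<close>, hence under \<open>H\<close>, while \<open>big\<close> keeps
    \<open>H (y (k n) - l)\<close> away from 0.\<close>
  obtain G' l' where G': "G' \<noteq> bot" "G' \<le> sequentially"
    "\<And>f :: 'a \<Rightarrow>\<^sub>L real. ((\<lambda>n. blinfun_apply f (y (k n))) \<longlongrightarrow> blinfun_apply f l') G'"
    using relatively_weakly_compact_cluster[where y = "\<lambda>n. y (k n)", OF K y] by blast
  have "blinfun_apply (h (k i)) l' = blinfun_apply (h (k i)) l" for i
  proof (rule tendsto_unique[OF G'(1) G'(3)])
    have "(\<lambda>j. \<epsilon> / 8 / real (Suc j)) \<longlonglongrightarrow> 0"
      by (rule LIMSEQ_Suc[OF lim_const_over_n])
    moreover have "eventually (\<lambda>j. norm (blinfun_apply (h (k i)) (y (k j) - l)) \<le> \<epsilon> / 8 / real (Suc j)) sequentially"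
      using eventually_gt_at_top[of i]
    proof eventually_elim
      case (elim j)
      have "\<bar>blinfun_apply (h (k i)) (y (k j) - l)\<bar> \<le> (\<Sum>i<Suc j. \<bar>blinfun_apply (h (s i)) (y (k j) - l)\<bar>)"
        using elim member_le_sum[of "Suc i" "{..<Suc j}" "\<lambda>i. \<bar>blinfun_apply (h (s i)) (y (k j) - l)\<bar>"]
        by (simp add: k_def)
      then show ?case using small[of j] by simp
    qed
    ultimately have "(\<lambda>j. blinfun_apply (h (k i)) (y (k j) - l)) \<longlonglongrightarrow> 0" by (rule Lim_null_comparison[rotated])
    then have "((\<lambda>j. blinfun_apply (h (k i)) (y (k j)) - blinfun_apply (h (k i)) l) \<longlongrightarrow> 0) G'"
      using G'(2) by (simp add: blinfun.diff_right tendsto_mono)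
    then show "((\<lambda>n. blinfun_apply (h (k i)) (y (k n))) \<longlongrightarrow> blinfun_apply (h (k i)) l) G'"
      by (simp add: LIM_zero_iff)
  qed
  then have "H l' = H l" by (simp add: H_def)
  then have "((\<lambda>n. blinfun_apply (Blinfun H) (y (k n) - l)) \<longlongrightarrow> 0) G'"
    using G'(3)[of "Blinfun H"] by (simp add: HB LIM_zero_iff blinfun.diff_right[of "Blinfun H", unfolded HB])
  then have "eventually (\<lambda>n. \<bar>H (y (k n) - l)\<bar> < \<epsilon> / 2) G'"
    using \<epsilon>(1) order_tendstoD(2)[OF tendsto_rabs, of _ 0 G' "\<epsilon> / 2"] by (simp add: HB)
  then show False using eventually_happens'[OF G'(1)] big by (meson not_le)
qed

lemma not_LIMSEQ_zero_subseq:
  fixes f :: "nat \<Rightarrow> real"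
  assumes "\<not> f \<longlonglongrightarrow> 0"
  obtains r :: "nat \<Rightarrow> nat" and \<epsilon> where "strict_mono r" "0 < \<epsilon>" "\<And>n. \<epsilon> \<le> \<bar>f (r n)\<bar>"
proof -
  obtain \<epsilon> where \<epsilon>: "0 < \<epsilon>" "\<forall>N. \<exists>n\<ge>N. \<epsilon> \<le> \<bar>f n\<bar>"
    using assms by (auto simp: LIMSEQ_def not_less)
  then have "infinite {n. \<epsilon> \<le> \<bar>f n\<bar>}" by (auto simp: infinite_nat_iff_unbounded_le)
  then obtain r :: "nat \<Rightarrow> nat" where "strict_mono r" "\<And>n. r n \<in> {n. \<epsilon> \<le> \<bar>f n\<bar>}"
    using infinite_enumerate by blast
  then show ?thesis using \<epsilon>(1) that by auto
qed

text \<open>If the limit failed, a subsequence would stay away from 0 and inherit the l1 bound,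
  which the preceding lemma excludes.\<close>

theorem l1_functionals_null_on_weakly_compact:
  fixes h :: "nat \<Rightarrow> ('a::real_normed_vector \<Rightarrow>\<^sub>L real)"
  assumes h: "\<And>z I. finite I \<Longrightarrow> (\<Sum>n\<in>I. \<bar>blinfun_apply (h n) z\<bar>) \<le> C * norm z"
    and K: "relatively_weakly_compact K" and y: "\<And>n. y n \<in> K"
  shows "(\<lambda>n. blinfun_apply (h n) (y n)) \<longlonglongrightarrow> 0"
proof (rule ccontr)
  assume "\<not> ?thesis"
  then obtain r :: "nat \<Rightarrow> nat" and \<epsilon> where r: "strict_mono r" "0 < \<epsilon>" "\<And>n::nat. \<epsilon> \<le> \<bar>blinfun_apply (h (r n)) (y (r n))\<bar>"
    by (rule not_LIMSEQ_zero_subseq) auto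
  show False
    by (rule l1_functionals_null_on_weakly_compact_aux[of "\<lambda>n. h (r n)" C K "\<lambda>n. y (r n)", OF _ K y r(2,3)])
      (rule sum_subsequence_le[OF h r(1)])
qed

section \<open>Disjoint sequences in solid hulls\<close>

lemma scaleR_inf:
  fixes x y :: "'a::banach_lattice"
  assumes c: "0 < c"
  shows "c *\<^sub>R inf x y = inf (c *\<^sub>R x) (c *\<^sub>R y)"
proof (rule order.antisym)
  show "c *\<^sub>R inf x y \<le> inf (c *\<^sub>R x) (c *\<^sub>R y)"
    using c by (simp add: scaleR_left_mono)
  have "inverse c *\<^sub>R inf (c *\<^sub>R x) (c *\<^sub>R y) \<le> inverse c *\<^sub>R (c *\<^sub>R z)" if "z = x \<or> z = y" for z
    using c that by (intro scaleR_left_mono) auto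
  then have "inverse c *\<^sub>R inf (c *\<^sub>R x) (c *\<^sub>R y) \<le> inf x y"
    using c by simp
  then have "c *\<^sub>R (inverse c *\<^sub>R inf (c *\<^sub>R x) (c *\<^sub>R y)) \<le> c *\<^sub>R inf x y"
    using c by (intro scaleR_left_mono) auto
  then show "inf (c *\<^sub>R x) (c *\<^sub>R y) \<le> c *\<^sub>R inf x y"
    using c by simp
qed

lemma disjoint_mono:
  fixes a b u v :: "'a::banach_lattice"
  assumes "inf u v = 0" "0 \<le> a" "0 \<le> b" "a \<le> u" "b \<le> v"
  shows "inf a b = 0"
  using inf_mono[OF assms(4,5)] assms(1-3) by (simp add: order.antisym)

lemma disjoint_scaleR:
  fixes u v :: "'a::banach_lattice"
  assumes d: "inf u v = 0" and ts: "0 \<le> t" "0 \<le> s"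
  shows "inf (t *\<^sub>R u) (s *\<^sub>R v) = 0"
proof -
  have uv: "0 \<le> u" "0 \<le> v" using d by (metis inf_le1, metis inf_le2)
  \<comment> \<open>One positive factor that dominates both \<open>t\<close> and
    \<open>s\<close>.\<close>
  define m where "m = t + s + 1"
  have "inf (m *\<^sub>R u) (m *\<^sub>R v) = 0"
    using scaleR_inf[of m u v] d ts by (simp add: m_def)
  then show ?thesis
    by (rule disjoint_mono) (use uv ts in \<open>auto simp: m_def intro!: scaleR_nonneg_nonneg scaleR_right_mono\<close>)
qed

text \<open>With \<open>z\<close> the left side, \<open>z - inf a c\<close> is the supremum of
  \<open>z - a\<close> and \<open>z - c\<close>, and both lie below \<open>inf b c\<close>.\<close>

lemma inf_add_le:
  fixes a b c :: "'a::banach_lattice"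
  assumes "0 \<le> a" "0 \<le> b" "0 \<le> c"
  shows "inf (a + b) c \<le> inf a c + inf b c"
proof -
  let ?z = "inf (a + b) c"
  have "?z - a \<le> b" by (simp add: diff_le_eq add.commute)
  moreover have "?z - a \<le> c" using add_mono[of ?z c 0 a] assms by (simp add: diff_le_eq)
  moreover have "?z - c \<le> inf b c" using assms by (simp add: diff_le_eq le_infI2)
  ultimately have "sup (?z - a) (?z - c) \<le> inf b c" by simp
  moreover have "?z - inf a c = sup (?z - a) (?z - c)"
    using add_sup_distrib_left[of ?z "- a" "- c"] by (simp add: diff_inf_eq_sup)
  ultimately have "?z - inf a c \<le> inf b c" by (simp only:)
  then show ?thesis by (simp only: diff_le_eq add.commute)
qed

lemma disjoint_sum:
  fixes a :: "'i \<Rightarrow> 'a::banach_lattice"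
  assumes "finite I" "\<And>i. i \<in> I \<Longrightarrow> 0 \<le> a i" "0 \<le> b" "\<And>i. i \<in> I \<Longrightarrow> inf (a i) b = 0"
  shows "inf (\<Sum>i\<in>I. a i) b = 0"
  using assms
proof (induction I)
  case (insert i I)
  then have "inf (a i + (\<Sum>i\<in>I. a i)) b \<le> inf (a i) b + inf (\<Sum>i\<in>I. a i) b"
    by (intro inf_add_le sum_nonneg) auto
  then show ?case using insert by (simp add: order.antisym sum_nonneg)
qed (simp add: inf_absorb1)

text \<open>The sum of two disjoint positive elements is their supremum; the rest is
  induction.\<close>

lemma disjoint_sum_le:
  fixes a :: "'i \<Rightarrow> 'a::banach_lattice"
  assumes "finite I" "\<And>i. i \<in> I \<Longrightarrow> 0 \<le> a i" "\<And>i. i \<in> I \<Longrightarrow> a i \<le> z" "0 \<le> z"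
    "\<And>i j. i \<in> I \<Longrightarrow> j \<in> I \<Longrightarrow> i \<noteq> j \<Longrightarrow> inf (a i) (a j) = 0"
  shows "(\<Sum>i\<in>I. a i) \<le> z"
  using assms
proof (induction I)
  case (insert i I)
  have "inf (\<Sum>i\<in>I. a i) (a i) = 0" using insert.prems insert.hyps by (intro disjoint_sum) auto
  moreover have "(\<Sum>i\<in>I. a i) \<le> z" using insert by auto
  ultimately show ?case
    using add_eq_inf_sup[of "\<Sum>i\<in>I. a i" "a i"] insert.hyps insert.prems by (simp add: add.commute)
qed simp

lemma disjoint_pprt:
  fixes x :: "'a::banach_lattice"
  shows "inf (pprt x) (pprt (- x)) = 0"
proof -
  have "pprt x + - x = pprt x - (pprt x + nprt x)" by (simp flip: prts)
  then have "pprt (- x) = pprt x + - x" by (simp add: pprt_neg flip: diff_diff_eq)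
  then have "inf (pprt x) (pprt (- x)) = inf (pprt x + 0) (pprt x + - x)" by simp
  then show ?thesis
    using add_inf_distrib_left[of "pprt x" 0 "- x"] nprt_neg[of x] by (simp add: nprt_def inf_commute)
qed

text \<open>The positive part of \<open>- l\<close> lies below the modulus of
  \<open>x n - l\<close>, so its norm is 0.\<close>

lemma nonneg_LIMSEQ:
  fixes x :: "nat \<Rightarrow> 'a::banach_lattice"
  assumes x: "\<And>n. 0 \<le> x n" and l: "x \<longlonglongrightarrow> l"
  shows "0 \<le> l"
proof -
  have "norm (pprt (- l)) \<le> norm (x n - l)" for n
  proof (rule norm_abs_mono)
    have "- l \<le> x n - l" using x[of n] by simp
    also have "\<dots> \<le> \<bar>x n - l\<bar>" by (rule abs_ge_self)
    finally have "pprt (- l) \<le> \<bar>x n - l\<bar>" by (simp add: pprt_def)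
    then show "\<bar>pprt (- l)\<bar> \<le> \<bar>x n - l\<bar>" by (simp add: abs_of_nonneg)
  qed
  moreover have "(\<lambda>n. norm (x n - l)) \<longlonglongrightarrow> 0" using l by (simp add: LIM_zero tendsto_norm_zero)
  ultimately have "norm (pprt (- l)) \<le> 0" by (intro LIMSEQ_le_const) auto
  then have "pprt (- l) = 0" by simp
  then show ?thesis by (simp flip: le_zero_iff_zero_pprt)
qed

section \<open>Positive functionals, moduli and components on disjoint vectors\<close>

lemma positive_op_mono: "positive_op T \<Longrightarrow> x \<le> y \<Longrightarrow> blinfun_apply T x \<le> blinfun_apply T y"
  using blinfun.diff_right[of T y x] diff_ge_0_iff_ge[of y x]
    diff_ge_0_iff_ge[of "blinfun_apply T y" "blinfun_apply T x"]
  unfolding positive_op_def by metis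

lemma positive_op_abs_le: "positive_op T \<Longrightarrow> \<bar>blinfun_apply T x\<bar> \<le> blinfun_apply T \<bar>x\<bar>"
  using positive_op_mono[of T x "\<bar>x\<bar>"] positive_op_mono[of T "- x" "\<bar>x\<bar>"]
  by (intro abs_leI) (simp_all add: abs_ge_self abs_ge_minus_self blinfun.minus_right)

lemma positive_op_dual_abs: "positive_op (dual_abs f)"
  and dual_abs_ge: "0 \<le> x \<Longrightarrow> \<bar>blinfun_apply f x\<bar> \<le> blinfun_apply (dual_abs f) x"
proof -
  have le: "\<bar>blinfun_apply f x\<bar> \<le> blinfun_apply (dual_abs f) x" if "0 \<le> x" for x
    using that dual_sup(1)[of f "- f"] dual_sup(2)[of "- f" f]
    by (simp add: dual_abs_def op_le_def blinfun.minus_left abs_le_iff)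
  then show "positive_op (dual_abs f)" unfolding positive_op_def by (meson abs_ge_zero order_trans)
  show "0 \<le> x \<Longrightarrow> \<bar>blinfun_apply f x\<bar> \<le> blinfun_apply (dual_abs f) x" by (rule le)
qed

lemma dual_abs_eq_self: "positive_op f \<Longrightarrow> dual_abs f = f"
  unfolding dual_abs_def
  by (rule dual_sup_eqI) (auto simp: positive_op_def op_le_def blinfun.minus_left intro: order_trans[of _ 0])

lemma dual_abs_apply_le: "\<bar>blinfun_apply f x\<bar> \<le> blinfun_apply (dual_abs f) \<bar>x\<bar>"
proof -
  have "blinfun_apply f x = blinfun_apply f (pprt x) - blinfun_apply f (pprt (- x))"
    using prts[of x] blinfun.diff_right[of f "pprt x" "pprt (- x)"] by (simp add: pprt_neg)
  moreover have "\<bar>x\<bar> = pprt x + pprt (- x)" by (simp add: abs_prts pprt_neg)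
  ultimately show ?thesis
    using dual_abs_ge[of "pprt x" f] dual_abs_ge[of "pprt (- x)" f]
    by (simp add: blinfun.add_right)
qed

text \<open>The component of \<open>f\<close> on the band generated by \<open>u\<close>.\<close>

lemma component_functional:
  fixes f :: "'a::banach_lattice \<Rightarrow>\<^sub>L real"
  assumes f: "positive_op f" and u: "0 \<le> u"
  obtains h :: "'a \<Rightarrow>\<^sub>L real"
  where "\<And>z t. 0 \<le> z \<Longrightarrow> 0 \<le> t \<Longrightarrow> blinfun_apply f (inf z (t *\<^sub>R u)) \<le> blinfun_apply h z"
    and "\<And>z c. 0 \<le> z \<Longrightarrow> (\<And>t. 0 \<le> t \<Longrightarrow> blinfun_apply f (inf z (t *\<^sub>R u)) \<le> c)
      \<Longrightarrow> blinfun_apply h z \<le> c"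
proof -
  define v where "v z t = blinfun_apply f (inf z (t *\<^sub>R u))" for z t
  define p where "p z = (SUP t\<in>{0..}. v z t)" for z
  have vf: "v z t \<le> blinfun_apply f z" for z t
    unfolding v_def by (intro positive_op_mono[OF f]) simp
  have pu: "v z t \<le> p z" if "0 \<le> t" for z t
    unfolding p_def using that vf
    by (intro cSUP_upper bdd_aboveI2[where M = "blinfun_apply f z"]) auto
  have pl: "p z \<le> c" if "\<And>t. 0 \<le> t \<Longrightarrow> v z t \<le> c" for z c
    unfolding p_def using that by (intro cSUP_least) auto
  have tu: "0 \<le> t *\<^sub>R u" if "0 \<le> t" for t using u that by (rule scaleR_nonneg_nonneg[rotated])
  have p0: "0 \<le> p z" if "0 \<le> z" for z
    using pu[of 0 z] that by (simp add: v_def inf_absorb2 blinfun.zero_right)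
  \<comment> \<open>One inequality is \<open>inf_add_le\<close>. For the other, truncations at
    \<open>t u\<close> and \<open>s u\<close> add up to an element below the truncation of the sum
    at \<open>(t + s) u\<close>.\<close>
  have add: "p (x + y) = p x + p y" if xy: "0 \<le> x" "0 \<le> y" for x y
  proof (rule order.antisym)
    show "p (x + y) \<le> p x + p y"
    proof (rule pl)
      fix t :: real assume t: "0 \<le> t"
      have "v (x + y) t \<le> v x t + v y t"
        unfolding v_def blinfun.add_right[symmetric]
        by (intro positive_op_mono[OF f] inf_add_le xy tu t)
      then show "v (x + y) t \<le> p x + p y" using pu[OF t, of x] pu[OF t, of y] by simp
    qed
    have "p x \<le> p (x + y) - p y"
    proof (rule pl)
      fix t :: real assume t: "0 \<le> t"
      have "p y \<le> p (x + y) - v x t"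
      proof (rule pl)
        fix s :: real assume s: "0 \<le> s"
        have "v x t + v y s \<le> v (x + y) (t + s)"
          unfolding v_def blinfun.add_right[symmetric]
          by (intro positive_op_mono[OF f]) (simp add: add_mono scaleR_add_left)
        then show "v y s \<le> p (x + y) - v x t" using pu[of "t + s" "x + y"] s t by simp
      qed
      then show "v x t \<le> p (x + y) - p y" by simp
    qed
    then show "p x + p y \<le> p (x + y)" by simp
  qed
  have hom_ge: "c * p z \<le> p (c *\<^sub>R z)" if c: "0 < c" for c z
  proof -
    have "p z \<le> p (c *\<^sub>R z) / c"
    proof (rule pl)
      fix t :: real assume t: "0 \<le> t"
      have "c * v z t = blinfun_apply f (c *\<^sub>R inf z (t *\<^sub>R u))"
        by (simp add: v_def blinfun.scaleR_right)
      then have "c * v z t = v (c *\<^sub>R z) (c * t)" by (simp add: v_def scaleR_inf[OF c])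
      then show "v z t \<le> p (c *\<^sub>R z) / c"
        using pu[of "c * t" "c *\<^sub>R z"] c t by (simp add: field_simps)
    qed
    then show ?thesis using c by (simp add: field_simps)
  qed
  have hom: "p (c *\<^sub>R z) = c * p z" if c: "0 < c" for c z
    using hom_ge[OF c, of z] hom_ge[of "inverse c" "c *\<^sub>R z"] c by (simp add: field_simps)
  have bdd: "\<bar>p z\<bar> \<le> norm f * norm z" if "0 \<le> z" for z
    using p0[OF that] pl[OF vf, of z] norm_blinfun[of f z] by simp
  obtain h where "\<forall>z\<ge>0. blinfun_apply h z = p z"
    using functional_extension[of p "norm f"] add hom bdd by auto
  then show ?thesis using that[of h] pu pl by (simp add: v_def)
qed

text \<open>This is the l1 bound required by Schur's theorem. Truncations of a positive
  \<open>z\<close> by multiples of the disjoint \<open>u n\<close> are disjoint and below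
  \<open>z\<close>, so their sum is below \<open>z\<close>, and \<open>f\<close> is
  monotone.\<close>

lemma disjoint_components_bound:
  fixes f :: "'a::banach_lattice \<Rightarrow>\<^sub>L real" and u :: "'i \<Rightarrow> 'a" and I :: "'i set"
  assumes f: "positive_op f" and u: "\<And>n. 0 \<le> u n" "\<And>n m. n \<noteq> m \<Longrightarrow> inf (u n) (u m) = 0"
    and ge: "\<And>n z t. 0 \<le> z \<Longrightarrow> 0 \<le> t \<Longrightarrow> blinfun_apply f (inf z (t *\<^sub>R u n)) \<le> blinfun_apply (h n) z"
    and le: "\<And>n z c. 0 \<le> z \<Longrightarrow> (\<And>t. 0 \<le> t \<Longrightarrow> blinfun_apply f (inf z (t *\<^sub>R u n)) \<le> c)
      \<Longrightarrow> blinfun_apply (h n) z \<le> c"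
    and I: "finite I"
  shows "(\<Sum>n\<in>I. \<bar>blinfun_apply (h n) z\<bar>) \<le> norm f * norm z"
proof -
  have nonneg: "positive_op (h n)" for n
    unfolding positive_op_def using ge[of _ 0 n] by (simp add: inf_absorb2 blinfun.zero_right)
  have "(\<Sum>n\<in>I. blinfun_apply (h n) z) \<le> blinfun_apply f z" if z: "0 \<le> z" for z
  proof (rule field_le_epsilon)
    fix e :: real assume e: "0 < e"
    \<comment> \<open>Each component is approximated up to \<open>d\<close>; the total error
      \<open>card I * d\<close> stays below \<open>e\<close>, also for empty
      \<open>I\<close>.\<close>
    define d where "d = e / (real (card I) + 1)"
    have d: "0 < d" using e by (simp add: d_def)
    have "\<exists>t\<ge>0. blinfun_apply (h n) z - d < blinfun_apply f (inf z (t *\<^sub>R u n))" for n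
      using le[OF z, of n "blinfun_apply (h n) z - d"] d by (force simp: not_le)
    then obtain t where t: "\<And>n. 0 \<le> t n"
      "\<And>n. blinfun_apply (h n) z - d < blinfun_apply f (inf z (t n *\<^sub>R u n))" by metis
    have tu: "0 \<le> t n *\<^sub>R u n" for n using t u by (simp add: scaleR_nonneg_nonneg)
    have "(\<Sum>n\<in>I. blinfun_apply (h n) z) - card I * d = (\<Sum>n\<in>I. blinfun_apply (h n) z - d)"
      by (simp add: sum_subtractf)
    also have "\<dots> \<le> (\<Sum>n\<in>I. blinfun_apply f (inf z (t n *\<^sub>R u n)))"
      using t(2) by (intro sum_mono) (simp add: less_imp_le)
    also have "\<dots> = blinfun_apply f (\<Sum>n\<in>I. inf z (t n *\<^sub>R u n))" by (simp add: blinfun.sum_right)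
    also have "\<dots> \<le> blinfun_apply f z"
    proof (intro positive_op_mono[OF f] disjoint_sum_le I z)
      fix i j :: 'i assume "i \<noteq> j"
      then show "inf (inf z (t i *\<^sub>R u i)) (inf z (t j *\<^sub>R u j)) = 0"
        by (intro disjoint_mono[OF disjoint_scaleR[OF u(2) t(1)[of i] t(1)[of j]]]) (use z tu in auto)
    qed (use z tu in auto)
    finally have "(\<Sum>n\<in>I. blinfun_apply (h n) z) \<le> blinfun_apply f z + card I * d" by simp
    also have "card I * d \<le> e" using e by (simp add: d_def field_simps)
    finally show "(\<Sum>n\<in>I. blinfun_apply (h n) z) \<le> blinfun_apply f z + e" by simp
  qed
  then have "(\<Sum>n\<in>I. blinfun_apply (h n) \<bar>z\<bar>) \<le> blinfun_apply f \<bar>z\<bar>" by simp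
  also have "\<dots> \<le> norm f * norm \<bar>z\<bar>" using norm_blinfun[of f "\<bar>z\<bar>"] by simp
  also have "norm \<bar>z\<bar> \<le> norm z" by (rule norm_abs_mono) simp
  finally have "(\<Sum>n\<in>I. blinfun_apply (h n) \<bar>z\<bar>) \<le> norm f * norm z" by (simp add: mult_left_mono)
  moreover have "(\<Sum>n\<in>I. \<bar>blinfun_apply (h n) z\<bar>) \<le> (\<Sum>n\<in>I. blinfun_apply (h n) \<bar>z\<bar>)"
    by (intro sum_mono positive_op_abs_le nonneg)
  ultimately show ?thesis by simp
qed

text \<open>Schur's theorem controls \<open>h n\<close> at \<open>y n\<close> itself, not at its
  positive part. But the negative part of \<open>c y n\<close> is disjoint from \<open>u n\<close>,
  so \<open>h n\<close> is at most 0 on it, and \<open>f (u n) <= h n (c y n)\<close>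
  follows.\<close>

lemma disjoint_below_pprt_null:
  fixes f :: "'a::banach_lattice \<Rightarrow>\<^sub>L real" and c :: real
  assumes f: "positive_op f" and u: "\<And>n. 0 \<le> u n" "\<And>n m. n \<noteq> m \<Longrightarrow> inf (u n) (u m) = 0"
    and K: "relatively_weakly_compact K" and y: "\<And>n. y n \<in> K"
    and uy: "\<And>n. u n \<le> pprt (c *\<^sub>R y n)"
  shows "(\<lambda>n. blinfun_apply f (u n)) \<longlonglongrightarrow> 0"
proof -
  have "\<exists>h :: 'a \<Rightarrow>\<^sub>L real.
    (\<forall>z\<ge>0. \<forall>t\<ge>0. blinfun_apply f (inf z (t *\<^sub>R u n)) \<le> blinfun_apply h z) \<and>
    (\<forall>z\<ge>0. \<forall>c. (\<forall>t\<ge>0. blinfun_apply f (inf z (t *\<^sub>R u n)) \<le> c) \<longrightarrow> blinfun_apply h z \<le> c)" for n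
    using component_functional[OF f u(1)[of n]] by metis
  then obtain h :: "nat \<Rightarrow> ('a \<Rightarrow>\<^sub>L real)" where
    ge: "\<And>n z t. 0 \<le> z \<Longrightarrow> 0 \<le> t \<Longrightarrow> blinfun_apply f (inf z (t *\<^sub>R u n)) \<le> blinfun_apply (h n) z" and
    le: "\<And>n z c. 0 \<le> z \<Longrightarrow> (\<And>t. 0 \<le> t \<Longrightarrow> blinfun_apply f (inf z (t *\<^sub>R u n)) \<le> c)
      \<Longrightarrow> blinfun_apply (h n) z \<le> c"
    by metis
  have "(\<lambda>n. blinfun_apply (h n) (y n)) \<longlonglongrightarrow> 0"
    by (rule l1_functionals_null_on_weakly_compact[where C = "norm f", OF _ K y])
      (rule disjoint_components_bound[OF f u ge le])
  then have lim: "(\<lambda>n. blinfun_apply (h n) (c *\<^sub>R y n)) \<longlonglongrightarrow> 0"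
    using tendsto_mult_right_zero[of _ _ c] by (simp add: blinfun.scaleR_right)
  have "blinfun_apply f (u n) \<le> blinfun_apply (h n) (c *\<^sub>R y n)" for n
  proof -
    let ?y = "c *\<^sub>R y n"
    have "blinfun_apply f (u n) \<le> blinfun_apply (h n) (pprt ?y)"
      using ge[of "pprt ?y" 1 n] uy[of n] by (simp add: inf_absorb2)
    moreover have "blinfun_apply (h n) (pprt (- ?y)) \<le> 0"
    proof (rule le)
      fix t :: real assume t: "0 \<le> t"
      have "inf (pprt (- ?y)) (t *\<^sub>R u n) = 0"
      proof (rule disjoint_mono)
        show "inf (1 *\<^sub>R pprt (- ?y)) (t *\<^sub>R pprt ?y) = 0"
          using disjoint_pprt[of ?y] t by (intro disjoint_scaleR) (simp_all add: inf_commute)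
      qed (use t u uy in \<open>auto intro: scaleR_nonneg_nonneg scaleR_left_mono\<close>)
      then show "blinfun_apply f (inf (pprt (- ?y)) (t *\<^sub>R u n)) \<le> 0" by (simp add: blinfun.zero_right)
    qed simp
    moreover have "blinfun_apply (h n) ?y = blinfun_apply (h n) (pprt ?y) - blinfun_apply (h n) (pprt (- ?y))"
      using prts[of ?y] blinfun.diff_right[of "h n" "pprt ?y" "pprt (- ?y)"] by (simp add: pprt_neg)
    ultimately show ?thesis by simp
  qed
  moreover have "0 \<le> blinfun_apply f (u n)" for n using f u by (simp add: positive_op_def)
  ultimately show ?thesis by (intro tendsto_sandwich[OF _ _ tendsto_const lim]) auto
qed

text \<open>The modulus of \<open>y n\<close> is the sum of the positive parts of \<open>y n\<close>
  and \<open>- y n\<close>. Hence \<open>w n\<close> is at most the sum of its truncations by these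
  two, and the preceding lemma applies to each with \<open>c = 1\<close> and
  \<open>c = - 1\<close>.\<close>

theorem disjoint_in_solid_hull_weakly_null:
  fixes w :: "nat \<Rightarrow> 'a::banach_lattice" and \<phi> :: "'a \<Rightarrow>\<^sub>L real"
  assumes K: "relatively_weakly_compact K" and y: "\<And>n. y n \<in> K"
    and w: "\<And>n. 0 \<le> w n" "\<And>n. w n \<le> \<bar>y n\<bar>" "\<And>n m. n \<noteq> m \<Longrightarrow> inf (w n) (w m) = 0"
  shows "(\<lambda>n. blinfun_apply \<phi> (w n)) \<longlonglongrightarrow> 0"
proof -
  let ?f = "dual_abs \<phi>"
  define u where "u c n = inf (pprt (c *\<^sub>R y n)) (w n)" for c :: real and n
  have null: "(\<lambda>n. blinfun_apply ?f (u c n)) \<longlonglongrightarrow> 0" for c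
  proof (rule disjoint_below_pprt_null[where c = c and y = y, OF positive_op_dual_abs _ _ K y])
    show "inf (u c n) (u c m) = 0" if "n \<noteq> m" for n m
      by (rule disjoint_mono[OF w(3)[OF that]]) (auto simp: u_def w(1))
  qed (auto simp: u_def w(1))
  have "\<bar>blinfun_apply \<phi> (w n)\<bar> \<le> blinfun_apply ?f (u 1 n) + blinfun_apply ?f (u (- 1) n)" for n
  proof -
    have "w n = inf (pprt (y n) + pprt (- y n)) (w n)"
      using w(2)[of n] by (simp add: abs_prts pprt_neg inf_absorb2)
    also have "\<dots> \<le> u 1 n + u (- 1) n" unfolding u_def using w(1) by (auto intro: inf_add_le)
    finally have "blinfun_apply ?f (w n) \<le> blinfun_apply ?f (u 1 n + u (- 1) n)"
      by (rule positive_op_mono[OF positive_op_dual_abs])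
    then show ?thesis using dual_abs_ge[OF w(1), of \<phi> n] by (simp add: blinfun.add_right)
  qed
  then have "eventually (\<lambda>n. norm (blinfun_apply \<phi> (w n))
    \<le> blinfun_apply ?f (u 1 n) + blinfun_apply ?f (u (- 1) n)) sequentially"
    by (simp add: always_eventually)
  moreover have "(\<lambda>n. blinfun_apply ?f (u 1 n) + blinfun_apply ?f (u (- 1) n)) \<longlonglongrightarrow> 0"
    using tendsto_add[OF null[of 1] null[of "- 1"]] by simp
  ultimately show ?thesis by (rule Lim_null_comparison)
qed

section \<open>Uniform convergence on moduli and domination\<close>

text \<open>As \<open>t * s >= 1\<close> and \<open>a >= 0\<close>, \<open>t (b - s a)\<close> is at
  most \<open>- (a - t b)\<close>. So the second positive part is below a multiple of the negative
  part of \<open>a - t b\<close>.\<close>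

lemma disjoint_pprt_diff:
  fixes a b :: "'a::banach_lattice"
  assumes ab: "0 \<le> a" "0 \<le> b" and ts: "0 \<le> t" "1 \<le> t * s"
  shows "inf (pprt (a - t *\<^sub>R b)) (pprt (b - s *\<^sub>R a)) = 0"
proof -
  have t: "0 < t" using ts by (cases "t = 0") auto
  let ?c = "a - t *\<^sub>R b"
  have "1 *\<^sub>R a \<le> (t * s) *\<^sub>R a" using ab ts by (intro scaleR_right_mono)
  then have "t *\<^sub>R (b - s *\<^sub>R a) \<le> - ?c" by (simp add: scaleR_diff_right)
  also have "\<dots> \<le> pprt (- ?c)" by (simp add: pprt_def)
  finally have "inverse t *\<^sub>R (t *\<^sub>R (b - s *\<^sub>R a)) \<le> inverse t *\<^sub>R pprt (- ?c)"
    using t by (intro scaleR_left_mono) auto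
  then have "b - s *\<^sub>R a \<le> inverse t *\<^sub>R pprt (- ?c)" using t by simp
  moreover have "0 \<le> inverse t *\<^sub>R pprt (- ?c)" using t by (intro scaleR_nonneg_nonneg) auto
  ultimately have le: "pprt (b - s *\<^sub>R a) \<le> inverse t *\<^sub>R pprt (- ?c)" by (simp add: pprt_def)
  have "inf (1 *\<^sub>R pprt ?c) (inverse t *\<^sub>R pprt (- ?c)) = 0"
    using t by (intro disjoint_scaleR disjoint_pprt) auto
  then show ?thesis by (rule disjoint_mono) (use le in simp_all)
qed

lemma summable_nonneg_term_le_suminf:
  fixes a :: "nat \<Rightarrow> 'a::banach_lattice"
  assumes a: "\<And>n. 0 \<le> a n" and sm: "summable a"
  shows "a n \<le> suminf a"
proof -
  have "0 \<le> suminf a - a n"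
  proof (rule nonneg_LIMSEQ)
    show "(\<lambda>N. (\<Sum>i<N + Suc n. a i) - a n) \<longlonglongrightarrow> suminf a - a n"
      using summable_LIMSEQ[OF sm] by (intro tendsto_diff tendsto_const) (rule LIMSEQ_ignore_initial_segment)
    show "0 \<le> (\<Sum>i<N + Suc n. a i) - a n" for N
    proof -
      have "(\<Sum>i\<in>{n}. a i) \<le> (\<Sum>i<N + Suc n. a i)" by (rule sum_mono2) (auto simp: a)
      then show ?thesis by simp
    qed
  qed
  then show ?thesis by simp
qed

text \<open>If the conclusion fails along \<open>x\<close>, then subtracting from \<open>\<bar>x\<^sub>r\<bar>\<close> large multiples of
  the earlier moduli and a small multiple of an upper bound \<open>v\<close> of the later ones leaves a disjoint
  sequence in the solid hull of \<open>K\<close> on which \<open>g\<close> is not uniformly null either.\<close>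

lemma uniformly_null_on_moduli:
  fixes g :: "nat \<Rightarrow> ('a::banach_lattice \<Rightarrow>\<^sub>L real)"
  assumes pos: "\<And>n. positive_op (g n)"
    and null: "\<And>x. (\<lambda>n. blinfun_apply (g n) x) \<longlonglongrightarrow> 0"
    and unif: "\<And>z \<epsilon>. (\<And>\<phi> :: 'a \<Rightarrow>\<^sub>L real. (\<lambda>n::nat. blinfun_apply \<phi> (z n)) \<longlonglongrightarrow> 0) \<Longrightarrow> 0 < \<epsilon> \<Longrightarrow>
      eventually (\<lambda>n. \<forall>m. \<bar>blinfun_apply (g n) (z m)\<bar> < \<epsilon>) sequentially"
    and K: "relatively_weakly_compact K" and \<epsilon>: "0 < \<epsilon>"
  shows "eventually (\<lambda>n. \<forall>x\<in>K. blinfun_apply (g n) \<bar>x\<bar> < \<epsilon>) sequentially"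
proof (rule ccontr)
  assume "\<not> ?thesis"
  then have "infinite {n. \<exists>x\<in>K. \<epsilon> \<le> blinfun_apply (g n) \<bar>x\<bar>}"
    unfolding eventually_sequentially infinite_nat_iff_unbounded_le by (auto simp: not_less)
  then obtain q :: "nat \<Rightarrow> nat" where q: "strict_mono q"
    "\<And>n. q n \<in> {n. \<exists>x\<in>K. \<epsilon> \<le> blinfun_apply (g n) \<bar>x\<bar>}"
    using infinite_enumerate by blast
  then have "\<forall>n. \<exists>x. x \<in> K \<and> \<epsilon> \<le> blinfun_apply (g (q n)) \<bar>x\<bar>" by blast
  then obtain x where x: "\<And>n. x n \<in> K" "\<And>n. \<epsilon> \<le> blinfun_apply (g (q n)) \<bar>x n\<bar>" by metis
  define G where "G n = g (q n)" for n
  have Gpos: "positive_op (G n)" for n by (simp add: G_def pos)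
  have Gnull: "(\<lambda>n. blinfun_apply (G n) v) \<longlonglongrightarrow> 0" for v
    using LIMSEQ_subseq_LIMSEQ[OF null q(1)] by (simp add: G_def o_def)
  obtain M where M: "\<And>n. norm (x n) \<le> M"
    using relatively_weakly_compact_imp_bounded[OF K] x(1) unfolding bounded_iff by blast
  \<comment> \<open>The earlier moduli form one fixed vector, on which \<open>G n\<close> tends to
    0; \<open>n\<close> is taken so late that even its large multiple costs less than
    \<open>\<epsilon> / 4\<close>.\<close>
  define Q where "Q k p n \<longleftrightarrow> p < n
    \<and> blinfun_apply (G n) (4 ^ Suc k *\<^sub>R (\<Sum>i\<le>p. \<bar>x i\<bar>)) < \<epsilon> / 4" for k p n
  have "\<exists>n. Q k p n" for k p
  proof -
    have "eventually (\<lambda>n. blinfun_apply (G n) (4 ^ Suc k *\<^sub>R (\<Sum>i\<le>p. \<bar>x i\<bar>)) < \<epsilon> / 4) sequentially"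
      using \<epsilon> by (intro order_tendstoD(2)[OF Gnull]) simp
    then have "eventually (Q k p) sequentially"
      using eventually_gt_at_top[of p] unfolding Q_def by eventually_elim auto
    then show ?thesis using eventually_happens'[OF sequentially_bot] by blast
  qed
  then obtain r where r: "\<And>k. Q k (r k) (r (Suc k))"
    using dependent_nat_choice[of "\<lambda>_ _. True" Q] by auto
  have rm: "strict_mono r" using r unfolding Q_def by (intro strict_monoI_Suc) auto
  define b where "b k = \<bar>x (r (Suc k))\<bar>" for k
  define s where "s k = (\<Sum>i\<le>r k. \<bar>x i\<bar>)" for k
  define v where "v = (\<Sum>k. (1 / 2) ^ k *\<^sub>R b k)"
  have b0: "0 \<le> b k" for k by (simp add: b_def)
  have s0: "0 \<le> s k" for k by (simp add: s_def sum_nonneg)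
  have nb: "norm (b k) \<le> M" for k
    using norm_abs_mono[of "b k" "x (r (Suc k))"] M[of "r (Suc k)"] by (simp add: b_def)
  have "summable (\<lambda>k. M * (1 / 2) ^ k)" by (intro summable_mult summable_geometric) simp
  then have smv: "summable (\<lambda>k. (1 / 2) ^ k *\<^sub>R b k)"
    by (rule summable_comparison_test') (use nb in \<open>simp add: field_simps\<close>)
  have tv0: "0 \<le> (1 / 2) ^ k *\<^sub>R b k" for k by (intro scaleR_nonneg_nonneg b0) simp
  have bv: "(1 / 2) ^ k *\<^sub>R b k \<le> v" for k
    unfolding v_def by (rule summable_nonneg_term_le_suminf[OF tv0 smv])
  have v0: "0 \<le> v" using bv[of 0] b0[of 0] by (simp add: order_trans)
  have bs: "b k \<le> s j" if "k < j" for k j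
  proof -
    have "r (Suc k) \<le> r j" using that strict_mono_less_eq[OF rm] by simp
    then have "(\<Sum>i\<in>{r (Suc k)}. \<bar>x i\<bar>) \<le> s j" unfolding s_def by (intro sum_mono2) auto
    then show ?thesis by (simp add: b_def)
  qed
  define w where "w k = pprt (b k - 4 ^ Suc k *\<^sub>R s k - (1 / 2) ^ k *\<^sub>R v)" for k
  have cs0: "0 \<le> (4::real) ^ Suc k *\<^sub>R s k" for k by (intro scaleR_nonneg_nonneg s0) simp
  have cv0: "0 \<le> (1 / 2 :: real) ^ k *\<^sub>R v" for k by (intro scaleR_nonneg_nonneg v0) simp
  have disj: "inf (w k) (w j) = 0" if kj: "k < j" for k j
  proof (rule disjoint_mono)
    \<comment> \<open>For \<open>k < j\<close>, the term with \<open>v\<close> in \<open>w k\<close>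
      removes at least \<open>?t\<close> times \<open>b j\<close>, and the term with
      \<open>s j\<close> in \<open>w j\<close> removes at least \<open>4 ^ Suc j\<close> times
      \<open>b k\<close>. The product of these factors is at least
      \<open>4 ^ (- j) * 4 ^ Suc j = 4\<close>, enough for
      \<open>disjoint_pprt_diff\<close>.\<close>
    let ?t = "(1 / 2 :: real) ^ k * (1 / 2) ^ j"
    have "(1 / 2 :: real) ^ j \<le> (1 / 2) ^ k" using kj by (intro power_decreasing) auto
    then have "(1 / 2) ^ j * (1 / 2) ^ j * (4::real) ^ Suc j \<le> ?t * 4 ^ Suc j"
      by (intro mult_right_mono) auto
    moreover have "(1 / 2) ^ j * (1 / 2) ^ j * (4::real) ^ Suc j = 4"
      by (simp flip: power_mult_distrib)
    ultimately have "1 \<le> ?t * 4 ^ Suc j" by linarith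
    then show "inf (pprt (b k - ?t *\<^sub>R b j)) (pprt (b j - 4 ^ Suc j *\<^sub>R b k)) = 0"
      by (intro disjoint_pprt_diff b0) auto
    have "(1 / 2) ^ k *\<^sub>R ((1 / 2) ^ j *\<^sub>R b j) \<le> (1 / 2 :: real) ^ k *\<^sub>R v"
      by (intro scaleR_left_mono bv) simp
    then have "b k - 4 ^ Suc k *\<^sub>R s k - (1 / 2) ^ k *\<^sub>R v \<le> b k - 0 - ?t *\<^sub>R b j"
      by (intro diff_mono cs0) auto
    then show "w k \<le> pprt (b k - ?t *\<^sub>R b j)" unfolding w_def by simp
    have "4 ^ Suc j *\<^sub>R b k \<le> (4 :: real) ^ Suc j *\<^sub>R s j"
      by (intro scaleR_left_mono bs kj) simp
    then have "b j - 4 ^ Suc j *\<^sub>R s j - (1 / 2) ^ j *\<^sub>R v \<le> b j - 4 ^ Suc j *\<^sub>R b k - 0"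
      by (intro diff_mono cv0) auto
    then show "w j \<le> pprt (b j - 4 ^ Suc j *\<^sub>R b k)" unfolding w_def by simp
  qed (simp_all add: w_def)
  have wle: "w k \<le> b k" for k
  proof -
    have "b k - 4 ^ Suc k *\<^sub>R s k - (1 / 2) ^ k *\<^sub>R v \<le> b k - 0 - 0"
      by (intro diff_mono cs0 cv0) simp
    then show ?thesis using b0[of k] by (simp add: w_def pprt_def)
  qed
  have wnull: "(\<lambda>n. blinfun_apply \<phi> (w n)) \<longlonglongrightarrow> 0" for \<phi> :: "'a \<Rightarrow>\<^sub>L real"
  proof (rule disjoint_in_solid_hull_weakly_null[OF K])
    show "x (r (Suc n)) \<in> K" for n by (rule x)
    show "inf (w n) (w m) = 0" if "n \<noteq> m" for n m
      using that disj[of n m] disj[of m n] by (cases n m rule: linorder_cases) (auto simp: inf_commute)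
    show "w n \<le> \<bar>x (r (Suc n))\<bar>" for n using wle[of n] by (simp add: b_def)
  qed (simp add: w_def)
  have e4: "0 < \<epsilon> / 4" using \<epsilon> by simp
  \<comment> \<open>The bound holds for all \<open>m\<close> at once, so the mismatch between
    \<open>G n\<close> and \<open>w N\<close> below is harmless.\<close>
  have "eventually (\<lambda>n. \<forall>m. \<bar>blinfun_apply (G n) (w m)\<bar> < \<epsilon> / 4) sequentially"
    using eventually_subseq[OF q(1) unif[OF wnull e4]] by (simp add: G_def)
  moreover have "eventually (\<lambda>n. blinfun_apply (G n) v < \<epsilon> / 4) sequentially"
    by (rule order_tendstoD(2)[OF Gnull e4])
  ultimately obtain N where N: "\<And>n m. N \<le> n \<Longrightarrow> \<bar>blinfun_apply (G n) (w m)\<bar> < \<epsilon> / 4"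
    "\<And>n. N \<le> n \<Longrightarrow> blinfun_apply (G n) v < \<epsilon> / 4"
    using eventually_conj[THEN eventually_sequentially[THEN iffD1]] by blast
  \<comment> \<open>With this index \<open>b N\<close> is the modulus of \<open>x n\<close>. It lies
    below \<open>w N\<close> plus the two subtracted terms; \<open>G n\<close> is less than
    \<open>\<epsilon> / 4\<close> on each of the three, but at least \<open>\<epsilon>\<close> on
    \<open>b N\<close>.\<close>
  define n where "n = r (Suc N)"
  have nN: "N \<le> n" using seq_suble[OF rm, of "Suc N"] by (simp add: n_def)
  have "b N = (b N - 4 ^ Suc N *\<^sub>R s N - (1 / 2) ^ N *\<^sub>R v) + (4 ^ Suc N *\<^sub>R s N + (1 / 2) ^ N *\<^sub>R v)"
    by (simp add: algebra_simps)
  also have "\<dots> \<le> w N + (4 ^ Suc N *\<^sub>R s N + (1 / 2) ^ N *\<^sub>R v)"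
    unfolding w_def by (intro add_right_mono) (simp add: pprt_def)
  finally have "blinfun_apply (G n) (b N)
      \<le> blinfun_apply (G n) (w N + (4 ^ Suc N *\<^sub>R s N + (1 / 2) ^ N *\<^sub>R v))"
    by (rule positive_op_mono[OF Gpos])
  also have "\<dots> = blinfun_apply (G n) (w N) + blinfun_apply (G n) (4 ^ Suc N *\<^sub>R s N)
      + (1 / 2) ^ N * blinfun_apply (G n) v"
    by (simp only: blinfun.add_right blinfun.scaleR_right real_scaleR_def add.assoc)
  also have "(1 / 2) ^ N * blinfun_apply (G n) v \<le> 1 * blinfun_apply (G n) v"
    using Gpos v0 by (intro mult_right_mono) (auto simp: positive_op_def power_le_one)
  finally have "blinfun_apply (G n) (b N)
      \<le> blinfun_apply (G n) (w N) + blinfun_apply (G n) (4 ^ Suc N *\<^sub>R s N) + blinfun_apply (G n) v"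
    by simp
  moreover have "blinfun_apply (G n) (4 ^ Suc N *\<^sub>R s N) < \<epsilon> / 4"
    using r[of N] by (simp only: Q_def n_def s_def)
  moreover have "\<epsilon> \<le> blinfun_apply (G n) (b N)" using x(2)[of n] by (simp add: G_def n_def b_def)
  ultimately show False using N(1)[OF nN, of N] N(2)[OF nN] \<epsilon> by linarith
qed

section \<open>Suprema as eventual uniform bounds, and the domination theorem\<close>

lemma ennreal_SUP_abs_LIMSEQ_zeroI:
  fixes f :: "nat \<Rightarrow> 'a \<Rightarrow> real"
  assumes "\<And>\<epsilon>. 0 < \<epsilon> \<Longrightarrow> eventually (\<lambda>n. \<forall>x\<in>A. \<bar>f n x\<bar> \<le> \<epsilon>) sequentially"
  shows "(\<lambda>n. SUP x\<in>A. ennreal \<bar>f n x\<bar>) \<longlonglongrightarrow> 0"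
proof (rule order_tendstoI)
  fix a :: ennreal assume "0 < a"
  then obtain c where c: "0 < c" "c < a" using dense by blast
  then obtain \<epsilon> where \<epsilon>: "c = ennreal \<epsilon>" "0 \<le> \<epsilon>" by (cases c) auto
  have "0 < \<epsilon>" using c \<epsilon> by simp
  from assms[OF this] show "eventually (\<lambda>n. (SUP x\<in>A. ennreal \<bar>f n x\<bar>) < a) sequentially"
  proof eventually_elim
    case (elim n)
    then have "(SUP x\<in>A. ennreal \<bar>f n x\<bar>) \<le> ennreal \<epsilon>"
      by (intro SUP_least ennreal_leI) auto
    then show ?case using c \<epsilon> by (simp add: le_less_trans)
  qed
qed simp

lemma almost_limited_eventually:
  assumes A: "almost_limited A" and f: "dual_disjoint_seq f" "weak_star_null f" and \<epsilon>: "0 < \<epsilon>"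
  shows "eventually (\<lambda>n. \<forall>y\<in>A. \<bar>blinfun_apply (f n) y\<bar> < \<epsilon>) sequentially"
proof -
  have "(\<lambda>n. SUP y\<in>A. ennreal \<bar>blinfun_apply (f n) y\<bar>) \<longlonglongrightarrow> 0"
    using A f by (simp add: almost_limited_def)
  then have "eventually (\<lambda>n. (SUP y\<in>A. ennreal \<bar>blinfun_apply (f n) y\<bar>) < ennreal \<epsilon>) sequentially"
    by (rule order_tendstoD(2)) (use \<epsilon> in simp)
  then show ?thesis
  proof eventually_elim
    case (elim n)
    show ?case
    proof
      fix y assume "y \<in> A"
      then have "ennreal \<bar>blinfun_apply (f n) y\<bar> \<le> (SUP y\<in>A. ennreal \<bar>blinfun_apply (f n) y\<bar>)"
        by (rule SUP_upper)
      then have "ennreal \<bar>blinfun_apply (f n) y\<bar> < ennreal \<epsilon>" using elim by (rule le_less_trans)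
      then show "\<bar>blinfun_apply (f n) y\<bar> < \<epsilon>" by (simp add: ennreal_less_iff)
    qed
  qed
qed

theorem corollary2p6:
  fixes S T :: "'e::banach_lattice \<Rightarrow>\<^sub>L 'f::banach_lattice"
  assumes "property_d TYPE('f)"
    and "positive_op S" and "positive_op T"
    and "op_le 0 S" and "op_le S T"
    and "weak_almost_limited T"
  shows "weak_almost_limited S"
  unfolding weak_almost_limited_def almost_limited_def
proof (intro allI impI conjI; (elim conjE)?)
  fix A :: "'e set"
  assume A: "relatively_weakly_compact A"
  show "bounded (blinfun_apply S ` A)"
    by (intro bounded_linear_image relatively_weakly_compact_imp_bounded[OF A] blinfun.bounded_linear_right)
  fix f :: "nat \<Rightarrow> ('f \<Rightarrow>\<^sub>L real)"
  assume f: "dual_disjoint_seq f" "weak_star_null f"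
  define h where "h n = dual_abs (f n)" for n
  have hpos: "positive_op (h n)" for n by (simp add: h_def positive_op_dual_abs)
  \<comment> \<open>A positive functional is its own modulus, so disjointness passes from
    \<open>f\<close> to the moduli.\<close>
  have h: "dual_disjoint_seq h"
    using f(1) dual_abs_eq_self[OF hpos] by (simp add: dual_disjoint_seq_def h_def)
  have hnull: "weak_star_null h"
    using assms(1) f by (simp add: property_d_def h_def[abs_def])
  have "eventually (\<lambda>n. \<forall>x\<in>A. blinfun_apply (h n o\<^sub>L T) \<bar>x\<bar> < \<epsilon>) sequentially" if "0 < \<epsilon>" for \<epsilon>
  proof (rule uniformly_null_on_moduli[OF _ _ _ A that])
    show "positive_op (h n o\<^sub>L T)" for n
      using hpos[of n] assms(3) by (simp add: positive_op_def)
    show "(\<lambda>n. blinfun_apply (h n o\<^sub>L T) x) \<longlonglongrightarrow> 0" for x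
      using hnull by (simp add: weak_star_null_iff)
    fix z :: "nat \<Rightarrow> 'e" and \<epsilon> :: real
    assume z: "\<And>\<phi> :: 'e \<Rightarrow>\<^sub>L real. (\<lambda>n. blinfun_apply \<phi> (z n)) \<longlonglongrightarrow> 0" and "0 < \<epsilon>"
    \<comment> \<open>The weakly null sequence is tested as a single set, which makes the bound
      uniform in \<open>m\<close>.\<close>
    have "almost_limited (blinfun_apply T ` insert 0 (range z))"
      using assms(6) relatively_weakly_compact_weakly_null[OF z] by (simp only: weak_almost_limited_def)
    from almost_limited_eventually[OF this h hnull \<open>0 < \<epsilon>\<close>]
    show "eventually (\<lambda>n. \<forall>m. \<bar>blinfun_apply (h n o\<^sub>L T) (z m)\<bar> < \<epsilon>) sequentially"
      by eventually_elim auto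
  qed
  note small = this
  \<comment> \<open>The moduli move inside one at a time: first past \<open>f n\<close>, then past
    \<open>S\<close>, which is finally replaced by \<open>T\<close> on the positive vector.\<close>
  have le: "\<bar>blinfun_apply (f n) (blinfun_apply S x)\<bar> \<le> blinfun_apply (h n o\<^sub>L T) \<bar>x\<bar>" for n x
  proof -
    have "\<bar>blinfun_apply (f n) (blinfun_apply S x)\<bar> \<le> blinfun_apply (h n) \<bar>blinfun_apply S x\<bar>"
      unfolding h_def by (rule dual_abs_apply_le)
    also have "\<bar>blinfun_apply S x\<bar> \<le> blinfun_apply T \<bar>x\<bar>"
      using positive_op_abs_le[OF assms(2), of x] assms(5) by (auto simp: op_le_def intro: order_trans)
    then have "blinfun_apply (h n) \<bar>blinfun_apply S x\<bar> \<le> blinfun_apply (h n) (blinfun_apply T \<bar>x\<bar>)"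
      by (rule positive_op_mono[OF hpos])
    finally show ?thesis by simp
  qed
  show "(\<lambda>n. SUP y\<in>blinfun_apply S ` A. ennreal \<bar>blinfun_apply (f n) y\<bar>) \<longlonglongrightarrow> 0"
  proof (rule ennreal_SUP_abs_LIMSEQ_zeroI)
    fix \<epsilon> :: real assume "0 < \<epsilon>"
    from small[OF this]
    show "eventually (\<lambda>n. \<forall>y\<in>blinfun_apply S ` A. \<bar>blinfun_apply (f n) y\<bar> \<le> \<epsilon>) sequentially"
    proof eventually_elim
      case (elim n)
      have "\<bar>blinfun_apply (f n) (blinfun_apply S x)\<bar> \<le> \<epsilon>" if "x \<in> A" for x
        using bspec[OF elim that] le[of n x] by linarith
      then show ?case by blast
    qed
  qed
qed

end
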